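(* The parameterized problem Stable Cutset[mod co-cluster] admits a polynomial kernelization to equivalent instances with $\mathcal{O}(|X|^3)$ vertices. That is, there is an algorithm running in time polynomial in the input size which, given a graph $G$ and a set $X\subseteq V(G)$ such that $G-X$ is a co-cluster graph, outputs a graph $G'$ and a set $X'\subseteq V(G')$ such that $G'-X'$ is a co-cluster graph, $G'$ has a stable cutset if and only if $G$ has a stable cutset, and $|V(G')|\le c\cdot |X|^3$ for some absolute constant $c$.
   Context: All graphs are finite and simple. A stable cutset of a graph $G$ is a set $S\subseteq V(G)$ whose vertices are pairwise non-adjacent and such that $G-S$ is disconnected (has at least two connected components); the empty set is a stable cutset of any disconnected graph. A co-cluster graph is a graph whose complement is a disjoint union of cliques, equivalently a join of stable sets (a complete multipartite graph). Stable Cutset[mod co-cluster]: input is a graph $G$ and $X\subseteq V(G)$ with $G-X$ a co-cluster graph; the parameter is $|X|$; the question is whether $G$ has a stable cutset. A kernelization may alternatively output a constant-size yes- or no-instance. *)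

theory Defs
  imports
    "Graph_Theory.Graph_Theory"
    "HOL-Library.Disjoint_Sets"
    "HOL-Computational_Algebra.Polynomial"
begin

section \<open>Stable cutsets and co-cluster graphs\<close>

text \<open>Finite simple graphs are the \<open>pair_graph\<close>s of the library: finite, loop-free, symmetric arc
  relation. An undirected edge is the pair of its two orientations, so the strongly connected
  components of such a graph are its connected components.\<close>

definition del_verts :: "'a pair_pre_digraph \<Rightarrow> 'a set \<Rightarrow> ('a, 'a \<times> 'a) pre_digraph" where
  "del_verts G S = with_proj G \<restriction> (pverts G - S)"

definition stable_set :: "'a pair_pre_digraph \<Rightarrow> 'a set \<Rightarrow> bool" where
  "stable_set G S \<longleftrightarrow> S \<subseteq> pverts G \<and> (\<forall>u\<in>S. \<forall>v\<in>S. (u, v) \<notin> parcs G)"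

text \<open>Counting components matters here: the library's \<open>connected\<close> is false on the graph
  without vertices, which is not disconnected.\<close>

definition disconnected :: "('a, 'b) pre_digraph \<Rightarrow> bool" where
  "disconnected H \<longleftrightarrow> 2 \<le> card (pre_digraph.sccs H)"

definition stable_cutset :: "'a pair_pre_digraph \<Rightarrow> 'a set \<Rightarrow> bool" where
  "stable_cutset G S \<longleftrightarrow> stable_set G S \<and> disconnected (del_verts G S)"

definition has_stable_cutset :: "'a pair_pre_digraph \<Rightarrow> bool" where
  "has_stable_cutset G \<longleftrightarrow> (\<exists>S. stable_cutset G S)"

definition complement :: "('a, 'b) pre_digraph \<Rightarrow> 'a pair_pre_digraph" where
  "complement H = \<lparr> pverts = verts H,
     parcs = {(u, v). u \<in> verts H \<and> v \<in> verts H \<and> u \<noteq> v \<and> (u, v) \<notin> arcs_ends H} \<rparr>"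

text \<open>Disjoint union of cliques; \<open>P\<close> is the set of the vertex sets of the cliques.\<close>

definition cluster_graph :: "'a pair_pre_digraph \<Rightarrow> bool" where
  "cluster_graph H \<longleftrightarrow> (\<exists>P. partition_on (pverts H) P \<and>
     parcs H = {(u, v). u \<noteq> v \<and> (\<exists>B\<in>P. u \<in> B \<and> v \<in> B)})"

definition co_cluster_graph :: "('a, 'b) pre_digraph \<Rightarrow> bool" where
  "co_cluster_graph H \<longleftrightarrow> cluster_graph (complement H)"

definition mod_co_cluster_instance :: "'a pair_pre_digraph \<Rightarrow> 'a set \<Rightarrow> bool" where
  "mod_co_cluster_instance G X \<longleftrightarrow>
     pair_graph G \<and> X \<subseteq> pverts G \<and> co_cluster_graph (del_verts G X)"

section \<open>Random access machines\<close>

text \<open>While-programs over a random access machine with registers, an unbounded memory with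
  indirect addressing, and a write-only output. The only arithmetic is addition and truncated
  subtraction, so a step lengthens the largest number by at most one bit and unit-cost
  running time is polynomially related to Turing machine time.\<close>

record ram_state =
  reg :: "nat \<Rightarrow> nat"
  mem :: "nat \<Rightarrow> nat"
  out :: "nat list"

datatype com =
    Skip
  | Const nat nat      \<comment> \<open>\<open>r\<^sub>i := k\<close>\<close>
  | Add nat nat nat    \<comment> \<open>\<open>r\<^sub>i := r\<^sub>j + r\<^sub>k\<close>\<close>
  | Sub nat nat nat    \<comment> \<open>\<open>r\<^sub>i := r\<^sub>j - r\<^sub>k\<close>\<close>
  | Load nat nat       \<comment> \<open>\<open>r\<^sub>i := mem[r\<^sub>j]\<close>\<close>
  | Store nat nat      \<comment> \<open>\<open>mem[r\<^sub>i] := r\<^sub>j\<close>\<close>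
  | Write nat          \<comment> \<open>append \<open>r\<^sub>i\<close> to the output\<close>
  | Seq com com
  | If nat com com     \<comment> \<open>branch on \<open>r\<^sub>i \<noteq> 0\<close>\<close>
  | While nat com      \<comment> \<open>loop as long as \<open>r\<^sub>i \<noteq> 0\<close>\<close>

text \<open>\<open>exec c s t s'\<close>: started in \<open>s\<close>, the program \<open>c\<close> halts in \<open>s'\<close> after \<open>t\<close> steps.\<close>

inductive exec :: "com \<Rightarrow> ram_state \<Rightarrow> nat \<Rightarrow> ram_state \<Rightarrow> bool" where
  Skip: "exec Skip s 1 s"
| Const: "exec (Const i k) s 1 (s\<lparr>reg := (reg s)(i := k)\<rparr>)"
| Add: "exec (Add i j k) s 1 (s\<lparr>reg := (reg s)(i := reg s j + reg s k)\<rparr>)"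
| Sub: "exec (Sub i j k) s 1 (s\<lparr>reg := (reg s)(i := reg s j - reg s k)\<rparr>)"
| Load: "exec (Load i j) s 1 (s\<lparr>reg := (reg s)(i := mem s (reg s j))\<rparr>)"
| Store: "exec (Store i j) s 1 (s\<lparr>mem := (mem s)(reg s i := reg s j)\<rparr>)"
| Write: "exec (Write i) s 1 (s\<lparr>out := out s @ [reg s i]\<rparr>)"
| Seq: "exec c s t s' \<Longrightarrow> exec d s' u s'' \<Longrightarrow> exec (Seq c d) s (t + u) s''"
| IfTrue: "reg s i \<noteq> 0 \<Longrightarrow> exec c s t s' \<Longrightarrow> exec (If i c d) s (t + 1) s'"
| IfFalse: "reg s i = 0 \<Longrightarrow> exec d s t s' \<Longrightarrow> exec (If i c d) s (t + 1) s'"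
| WhileFalse: "reg s i = 0 \<Longrightarrow> exec (While i c) s 1 s"
| WhileTrue: "reg s i \<noteq> 0 \<Longrightarrow> exec c s t s' \<Longrightarrow> exec (While i c) s' u s'' \<Longrightarrow>
    exec (While i c) s (t + u + 1) s''"

inductive_cases exec_elims:
  "exec Skip s t s'" "exec (Const i k) s t s'" "exec (Add i j k) s t s'" "exec (Sub i j k) s t s'"
  "exec (Load i j) s t s'" "exec (Store i j) s t s'" "exec (Write i) s t s'"
inductive_cases exec_SeqE: "exec (Seq c d) s t s'"
inductive_cases exec_IfE: "exec (If i c d) s t s'"
inductive_cases exec_WhileE: "exec (While i c) s t s'"

lemma exec_deterministic: "exec c s t s' \<Longrightarrow> exec c s u s'' \<Longrightarrow> t = u \<and> s' = s''"
proof (induction arbitrary: u s'' rule: exec.induct)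
  case (Seq c s t s' d v s1)
  from Seq.prems show ?case by (rule exec_SeqE) (use Seq.IH in metis)
next
  case (IfTrue s i c t s' d)
  from IfTrue.prems show ?case by (rule exec_IfE) (simp_all add: IfTrue.hyps IfTrue.IH)
next
  case (IfFalse s i d t s' c)
  from IfFalse.prems show ?case by (rule exec_IfE) (simp_all add: IfFalse.hyps IfFalse.IH)
next
  case (WhileFalse s i c)
  from WhileFalse.prems show ?case by (rule exec_WhileE) (simp_all add: WhileFalse.hyps)
next
  case (WhileTrue s i c t s' v s1)
  have *: "t = t' \<and> v = v'  \<and> s1 = s''"
    if "exec c s t' r" "exec (While i c) r v' s''" for t' r v'
  proof -
    from WhileTrue.IH(1)[OF that(1)] have "t = t'" "s' = r" by auto
    with WhileTrue.IH(2) that(2) show ?thesis by auto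
  qed
  from WhileTrue.prems show ?case
    by (rule exec_WhileE) (use WhileTrue.hyps in simp, use * in simp)
qed (erule exec_elims, simp)+

definition input_state :: "nat list \<Rightarrow> ram_state" where
  "input_state xs = \<lparr> reg = (\<lambda>i. 0),
     mem = (\<lambda>i. if i < length xs then xs ! i else 0), out = [] \<rparr>"

definition ram_computes_within :: "com \<Rightarrow> nat list \<Rightarrow> nat \<Rightarrow> nat list \<Rightarrow> bool" where
  "ram_computes_within c xs T ys \<longleftrightarrow>
     (\<exists>t s. exec c (input_state xs) t s \<and> t \<le> T \<and> out s = ys)"

text \<open>The encoding of \<open>(G, X)\<close> for an arbitrary enumeration \<open>vs\<close> of the vertices: their number,
  the characteristic vector of \<open>X\<close>, and the rows of the adjacency matrix. The names of
  the vertices are invisible to the program.\<close>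

definition enumerates :: "'a list \<Rightarrow> 'a pair_pre_digraph \<Rightarrow> bool" where
  "enumerates vs G \<longleftrightarrow> distinct vs \<and> set vs = pverts G"

definition encode :: "'a list \<Rightarrow> 'a pair_pre_digraph \<Rightarrow> 'a set \<Rightarrow> nat list" where
  "encode vs G X = length vs # map (\<lambda>v. of_bool (v \<in> X)) vs
     @ concat (map (\<lambda>u. map (\<lambda>v. of_bool ((u, v) \<in> parcs G)) vs) vs)"

end

theory Submission
  imports Defs
begin

text \<open>A stable cutset amounts to disjoint nonempty sets \<open>A\<close>, \<open>B\<close> without edges between them whose
  complement \<open>S\<close> is stable. In the co-cluster part \<open>G - X\<close>, non-adjacency means lying in the same
  part, so whether a vertex of \<open>G - X\<close> can be placed depends only on its part and on which of \<open>A\<close>,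
  \<open>B\<close>, \<open>S\<close> occur among its neighbours in \<open>X\<close>, and at most three neighbours witness an obstruction.
  Hence it suffices to keep, for every set of at most three vertices of \<open>X\<close>, common neighbours in
  up to three distinct parts. The restriction of \<open>(A, B)\<close> to the kept vertices can only fail to
  have two nonempty sides if some vertex has a stable neighbourhood; such a vertex is kept too,
  and together with three vertices in total it already yields a stable cutset.

  After renaming the vertices to \<open>0, \<dots>, n - 1\<close>, membership in the kept set is expressed by
  adjacency, \<open>X\<close> and the order using only connectives, quantifiers over vertices and counting, so
  nested loops decide it in polynomial time.\<close>

section \<open>Separations and stable cutsets\<close>

definition anticomplete :: "('a \<times> 'a) set \<Rightarrow> 'a set \<Rightarrow> 'a set \<Rightarrow> bool" where
  "anticomplete E A B \<longleftrightarrow> (\<forall>a\<in>A. \<forall>b\<in>B. (a, b) \<notin> E)"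

abbreviation independent :: "('a \<times> 'a) set \<Rightarrow> 'a set \<Rightarrow> bool" where
  "independent E S \<equiv> anticomplete E S S"

definition separation :: "'a set \<Rightarrow> ('a \<times> 'a) set \<Rightarrow> 'a set \<Rightarrow> 'a set \<Rightarrow> bool" where
  "separation V E A B \<longleftrightarrow> A \<subseteq> V \<and> B \<subseteq> V \<and> A \<inter> B = {} \<and> A \<noteq> {} \<and> B \<noteq> {} \<and>
     anticomplete E A B \<and> independent E (V - (A \<union> B))"

definition separable :: "'a set \<Rightarrow> ('a \<times> 'a) set \<Rightarrow> bool" where
  "separable V E \<longleftrightarrow> (\<exists>A B. separation V E A B)"

lemma anticompleteD: "anticomplete E A B \<Longrightarrow> a \<in> A \<Longrightarrow> b \<in> B \<Longrightarrow> (a, b) \<notin> E"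
  unfolding anticomplete_def by blast

lemma anticomplete_sym: "sym E \<Longrightarrow> anticomplete E A B \<Longrightarrow> anticomplete E B A"
  unfolding anticomplete_def by (blast dest: symD)

lemma anticomplete_Un_left:
  "anticomplete E (A \<union> A') B \<longleftrightarrow> anticomplete E A B \<and> anticomplete E A' B"
  unfolding anticomplete_def by blast

lemma anticomplete_Un_right:
  "anticomplete E A (B \<union> B') \<longleftrightarrow> anticomplete E A B \<and> anticomplete E A B'"
  unfolding anticomplete_def by blast

lemma separation_sym: "sym E \<Longrightarrow> separation V E A B \<Longrightarrow> separation V E B A"
  unfolding separation_def using anticomplete_sym[of E A B] by (simp add: Un_commute Int_commute)

lemma separation_restrict:
  assumes "separation V E A B" and "U \<subseteq> V" and "A \<inter> U \<noteq> {}" and "B \<inter> U \<noteq> {}"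
  shows "separation U E (A \<inter> U) (B \<inter> U)"
  using assms unfolding separation_def anticomplete_def by blast

lemma (in pseudo_graph) disconnected_iff_unreachable:
  "disconnected G \<longleftrightarrow> (\<exists>u\<in>verts G. \<exists>v\<in>verts G. \<not> u \<rightarrow>\<^sup>*\<^bsub>G\<^esub> v)"
proof
  assume "disconnected G"
  then have "2 \<le> card sccs_verts"
    by (simp add: disconnected_def card_sccs_verts)
  then obtain S T where ST: "S \<in> sccs_verts" "T \<in> sccs_verts" "S \<noteq> T"
    by (metis card_le_Suc0_iff_eq finite_sccs_verts not_less_eq_eq numeral_2_eq_2)
  then obtain u v where "u \<in> verts G" "v \<in> verts G" "S = scc_of u" "T = scc_of v"
    by (auto simp: sccs_verts_conv_scc_of)
  with ST(3) show "\<exists>u\<in>verts G. \<exists>v\<in>verts G. \<not> u \<rightarrow>\<^sup>*\<^bsub>G\<^esub> v"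
    by (metis scc_ofI_reachable scc_of_eq)
next
  assume "\<exists>u\<in>verts G. \<exists>v\<in>verts G. \<not> u \<rightarrow>\<^sup>*\<^bsub>G\<^esub> v"
  then obtain u v where uv: "u \<in> verts G" "v \<in> verts G" "\<not> u \<rightarrow>\<^sup>*\<^bsub>G\<^esub> v"
    by blast
  then have "scc_of u \<noteq> scc_of v"
    using in_scc_of_self[of v] by (auto simp: scc_of_def)
  then have "card {scc_of u, scc_of v} = 2"
    by simp
  moreover have "{scc_of u, scc_of v} \<subseteq> sccs_verts"
    using uv by (auto simp: sccs_verts_conv_scc_of)
  ultimately show "disconnected G"
    unfolding disconnected_def using card_mono[OF finite_sccs_verts] card_sccs_verts by metis
qed

lemma (in pseudo_graph) disconnected_iff_anticomplete:
  "disconnected G \<longleftrightarrow> (\<exists>A B. A \<union> B = verts G \<and> A \<inter> B = {} \<and> A \<noteq> {} \<and> B \<noteq> {} \<and>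
     anticomplete (arcs_ends G) A B)" (is "_ \<longleftrightarrow> (\<exists>A B. ?bipartition A B)")
proof
  assume "disconnected G"
  then obtain u v where uv: "u \<in> verts G" "v \<in> verts G" "\<not> u \<rightarrow>\<^sup>* v"
    unfolding disconnected_iff_unreachable by blast
  define A where "A = {w. u \<rightarrow>\<^sup>* w}"
  have "A \<subseteq> verts G" "u \<in> A" "v \<notin> A"
    using uv reachable_in_verts unfolding A_def by auto
  moreover have "anticomplete (arcs_ends G) A (verts G - A)"
    unfolding anticomplete_def A_def using reachable_adj_trans by blast
  ultimately have "?bipartition A (verts G - A)"
    using uv(2) by blast
  then show "\<exists>A B. ?bipartition A B"
    by blast
next
  assume "\<exists>A B. ?bipartition A B"
  then obtain A B a b where AB: "?bipartition A B" and ab: "a \<in> A" "b \<in> B"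
    by blast
  have "w \<in> A" if "a \<rightarrow>\<^sup>* w" for w
    using that
  proof (induction rule: reachable_induct)
    case base
    show ?case by fact
  next
    case (step x y)
    then have "y \<in> A \<union> B"
      using AB adj_in_verts(2) by blast
    with step show ?case
      using AB anticompleteD[of "arcs_ends G" A B x y] by blast
  qed
  then show "disconnected G"
    unfolding disconnected_iff_unreachable using AB ab by blast
qed

lemma verts_del_verts: "verts (del_verts G S) = pverts G - S"
  by (simp add: del_verts_def)

lemma arcs_ends_del_verts:
  "arcs_ends (del_verts G S) = {(u, v) \<in> parcs G. u \<in> pverts G - S \<and> v \<in> pverts G - S}"
  unfolding del_verts_def by (auto simp: arcs_ends_def arc_to_ends_def)

lemma pair_graph_iff:
  "pair_graph G \<longleftrightarrow> finite (pverts G) \<and> parcs G \<subseteq> pverts G \<times> pverts G \<and>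
     sym (parcs G) \<and> irrefl (parcs G)" (is "_ \<longleftrightarrow> ?R")
proof
  assume "pair_graph G"
  then interpret pair_graph G .
  show ?R
    using pair_sym_arcs in_arcsD1 in_arcsD2 pair_no_loops
    by (fastforce simp: symmetric_def irrefl_def pair_finite_verts)
next
  assume R: ?R
  then have "finite (parcs G)"
    by (auto intro: finite_subset)
  with R show "pair_graph G"
    by unfold_locales (auto simp: symmetric_def irrefl_def)
qed

lemma pseudo_graph_del_verts:
  assumes "pair_graph G"
  shows "pseudo_graph (del_verts G S)"
proof -
  interpret G: pair_graph G by fact
  have "induced_subgraph (del_verts G S) (with_proj G)"
    unfolding del_verts_def by (rule G.induced_induce) auto
  then interpret D: digraph "del_verts G S"
    using G.digraphI_induced by blast
  have "symmetric (del_verts G S)"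
    using G.pair_sym_arcs by (auto simp: symmetric_def arcs_ends_del_verts sym_def)
  then show ?thesis
    by unfold_locales
qed

lemma disconnected_del_verts_iff:
  assumes "pair_graph G"
  shows "disconnected (del_verts G S) \<longleftrightarrow> (\<exists>A B. A \<union> B = pverts G - S \<and> A \<inter> B = {} \<and>
    A \<noteq> {} \<and> B \<noteq> {} \<and> anticomplete (parcs G) A B)"
proof -
  have "anticomplete (arcs_ends (del_verts G S)) A B \<longleftrightarrow> anticomplete (parcs G) A B"
    if "A \<union> B = pverts G - S" for A B
  proof -
    have "A \<subseteq> pverts G - S" "B \<subseteq> pverts G - S"
      using that by blast+
    then show ?thesis
      unfolding arcs_ends_del_verts anticomplete_def by blast
  qed
  then show ?thesis
    unfolding pseudo_graph.disconnected_iff_anticomplete[OF pseudo_graph_del_verts[OF assms]]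
      verts_del_verts by meson
qed

lemma has_stable_cutset_iff_separable:
  assumes "pair_graph G"
  shows "has_stable_cutset G \<longleftrightarrow> separable (pverts G) (parcs G)"
proof
  assume "has_stable_cutset G"
  then obtain S A B where S: "stable_set G S" and AB: "A \<union> B = pverts G - S" "A \<inter> B = {}"
      "A \<noteq> {}" "B \<noteq> {}" "anticomplete (parcs G) A B"
    unfolding has_stable_cutset_def stable_cutset_def disconnected_del_verts_iff[OF assms] by blast
  then have "pverts G - (A \<union> B) = S"
    by (auto simp: stable_set_def)
  with S AB have "separation (pverts G) (parcs G) A B"
    by (auto simp: separation_def stable_set_def anticomplete_def)
  then show "separable (pverts G) (parcs G)"
    unfolding separable_def by blast
next
  assume "separable (pverts G) (parcs G)"
  then obtain A B where AB: "separation (pverts G) (parcs G) A B"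
    unfolding separable_def by blast
  define S where "S = pverts G - (A \<union> B)"
  have "A \<union> B = pverts G - S"
    using AB by (auto simp: separation_def S_def)
  with AB have "disconnected (del_verts G S)"
    unfolding disconnected_del_verts_iff[OF assms] separation_def by blast
  moreover have "stable_set G S"
    using AB by (auto simp: stable_set_def separation_def anticomplete_def S_def)
  ultimately show "has_stable_cutset G"
    unfolding has_stable_cutset_def stable_cutset_def by blast
qed

section \<open>Co-cluster modulators\<close>

definition nonadjacency :: "('a \<times> 'a) set \<Rightarrow> 'a set \<Rightarrow> ('a \<times> 'a) set" where
  "nonadjacency E N = {(u, v). u \<in> N \<and> v \<in> N \<and> (u, v) \<notin> E}"

lemma cluster_graph_iff:
  "cluster_graph H \<longleftrightarrow> (\<exists>r. equiv (pverts H) r \<and> parcs H = r - Id)"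
proof -
  have "{(u, v). u \<noteq> v \<and> (\<exists>B\<in>A // r. u \<in> B \<and> v \<in> B)} = r - Id" if r: "equiv A r"
    for A and r :: "('a \<times> 'a) set"
  proof -
    have "(u, v) \<in> r" if "B \<in> A // r" "u \<in> B" "v \<in> B" for B u v
      using in_quotient_imp_in_rel[OF r that(1)] that(2,3) by simp
    moreover have "\<exists>B\<in>A // r. u \<in> B \<and> v \<in> B" if "(u, v) \<in> r" for u v
    proof -
      have "u \<in> A" "(u, u) \<in> r"
        using r that by (auto simp: equiv_def refl_on_def)
      with that show ?thesis
        by (intro bexI[of _ "r `` {u}"]) (auto intro: quotientI)
    qed
    ultimately show ?thesis
      by auto
  qed
  moreover have "cluster_graph H \<longleftrightarrow> (\<exists>r. equiv (pverts H) r \<and>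
      parcs H = {(u, v). u \<noteq> v \<and> (\<exists>B\<in>pverts H // r. u \<in> B \<and> v \<in> B)})"
    unfolding cluster_graph_def partition_on_alt by blast
  ultimately show ?thesis
    by (simp cong: conj_cong)
qed

lemma co_cluster_graph_del_verts_iff:
  assumes "sym (parcs G)" and "irrefl (parcs G)"
  shows "co_cluster_graph (del_verts G X) \<longleftrightarrow> trans (nonadjacency (parcs G) (pverts G - X))"
proof -
  let ?N = "pverts G - X"
  let ?r = "nonadjacency (parcs G) ?N"
  have refl: "refl_on ?N ?r" "?r \<subseteq> ?N \<times> ?N"
    using assms(2) by (auto simp: nonadjacency_def irrefl_def refl_on_def)
  have "complement (del_verts G X) = \<lparr>pverts = ?N, parcs = ?r - Id\<rparr>"
    by (auto simp: complement_def verts_del_verts arcs_ends_del_verts nonadjacency_def)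
  then have "co_cluster_graph (del_verts G X) \<longleftrightarrow> (\<exists>r. equiv ?N r \<and> ?r - Id = r - Id)"
    by (simp add: co_cluster_graph_def cluster_graph_iff)
  also have "\<dots> \<longleftrightarrow> equiv ?N ?r"
  proof -
    have off_diagonal: "r = (r - Id) \<union> Id_on ?N" if "refl_on ?N r" "r \<subseteq> ?N \<times> ?N" for r
      using that by (auto simp: refl_on_def)
    have "r = ?r" if "equiv ?N r" "?r - Id = r - Id" for r
      using off_diagonal[of r] off_diagonal[OF refl] that by (simp add: equiv_def)
    then show ?thesis
      by blast
  qed
  also have "\<dots> \<longleftrightarrow> trans ?r"
  proof -
    have "sym ?r"
      using assms(1) by (auto simp: nonadjacency_def sym_def)
    then show ?thesis
      using refl by (simp add: equiv_def)
  qed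
  finally show ?thesis .
qed

locale co_cluster_modulator =
  fixes V :: "'a set" and E :: "('a \<times> 'a) set" and X :: "'a set"
  assumes finite_V: "finite V"
    and E_subset: "E \<subseteq> V \<times> V"
    and sym_E: "sym E"
    and irrefl_E: "irrefl E"
    and X_subset: "X \<subseteq> V"
    and trans_nonadjacency: "trans (nonadjacency E (V - X))"
begin

lemma adjacent_sym: "(u, v) \<in> E \<Longrightarrow> (v, u) \<in> E"
  using sym_E by (rule symD)

lemma not_adjacent_self: "(v, v) \<notin> E"
  using irrefl_E by (simp add: irrefl_def)

lemma nonadjacent_trans:
  assumes "u \<in> V - X" "v \<in> V - X" "w \<in> V - X" and "(u, v) \<notin> E" and "(v, w) \<notin> E"
  shows "(u, w) \<notin> E"
  using trans_nonadjacency assms unfolding trans_def nonadjacency_def by blast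

end

lemma mod_co_cluster_instance_iff:
  "mod_co_cluster_instance G X \<longleftrightarrow> co_cluster_modulator (pverts G) (parcs G) X"
  unfolding mod_co_cluster_instance_def pair_graph_iff co_cluster_modulator_def
  using co_cluster_graph_del_verts_iff by blast

section \<open>Relabelling\<close>

definition pullback :: "('b \<Rightarrow> 'a) \<Rightarrow> 'b set \<Rightarrow> 'a pair_pre_digraph \<Rightarrow> 'b pair_pre_digraph" where
  "pullback f U G = \<lparr>pverts = U, parcs = {(u, v). u \<in> U \<and> v \<in> U \<and> (f u, f v) \<in> parcs G}\<rparr>"

abbreviation induced :: "'a set \<Rightarrow> 'a pair_pre_digraph \<Rightarrow> 'a pair_pre_digraph" where
  "induced \<equiv> pullback (\<lambda>v. v)"

lemma pverts_pullback [simp]: "pverts (pullback f U G) = U"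
  by (simp add: pullback_def)

lemma mod_co_cluster_instance_pullback:
  assumes "mod_co_cluster_instance G X" and "finite U" and "f ` U \<subseteq> pverts G"
  shows "mod_co_cluster_instance (pullback f U G) {u \<in> U. f u \<in> X}"
proof -
  interpret co_cluster_modulator "pverts G" "parcs G" X
    using assms(1) by (simp add: mod_co_cluster_instance_iff)
  have "co_cluster_modulator U {(u, v). u \<in> U \<and> v \<in> U \<and> (f u, f v) \<in> parcs G} {u \<in> U. f u \<in> X}"
  proof
    let ?E = "{(u, v). u \<in> U \<and> v \<in> U \<and> (f u, f v) \<in> parcs G}"
    show "trans (nonadjacency ?E (U - {u \<in> U. f u \<in> X}))"
    proof (rule transI)
      fix u v w
      assume "(u, v) \<in> nonadjacency ?E (U - {u \<in> U. f u \<in> X})"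
        "(v, w) \<in> nonadjacency ?E (U - {u \<in> U. f u \<in> X})"
      moreover from this have "f u \<in> pverts G - X" "f v \<in> pverts G - X" "f w \<in> pverts G - X"
        using assms(3) by (auto simp: nonadjacency_def)
      ultimately show "(u, w) \<in> nonadjacency ?E (U - {u \<in> U. f u \<in> X})"
        using nonadjacent_trans[of "f u" "f v" "f w"] by (auto simp: nonadjacency_def)
    qed
  qed (use assms(2) in \<open>auto simp: not_adjacent_self intro!: symI irreflI intro: adjacent_sym\<close>)
  then show ?thesis
    by (simp add: mod_co_cluster_instance_iff pullback_def)
qed

lemma mod_co_cluster_instance_induced:
  assumes "mod_co_cluster_instance G X" and "X \<subseteq> U" and "U \<subseteq> pverts G"
  shows "mod_co_cluster_instance (induced U G) X"
proof -
  interpret co_cluster_modulator "pverts G" "parcs G" X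
    using assms(1) by (simp add: mod_co_cluster_instance_iff)
  have "{u \<in> U. u \<in> X} = X"
    using assms(2) by blast
  then show ?thesis
    using mod_co_cluster_instance_pullback[OF assms(1), of U "\<lambda>v. v"] assms(3)
      finite_subset[OF assms(3) finite_V] by simp
qed

lemma separable_inj_image_iff:
  assumes inj: "inj_on f U"
  shows "separable (f ` U) E \<longleftrightarrow> separable U {(u, v). u \<in> U \<and> v \<in> U \<and> (f u, f v) \<in> E}"
    (is "_ \<longleftrightarrow> separable U ?E")
proof
  assume "separable (f ` U) E"
  then obtain A B where "separation (f ` U) E A B"
    unfolding separable_def by blast
  then have "separation U ?E {u \<in> U. f u \<in> A} {u \<in> U. f u \<in> B}"
    unfolding separation_def anticomplete_def by auto
  then show "separable U ?E"
    unfolding separable_def by blast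
next
  assume "separable U ?E"
  then obtain A B where AB: "separation U ?E A B"
    unfolding separable_def by blast
  then have sides: "A \<subseteq> U" "B \<subseteq> U" "A \<inter> B = {}" "A \<noteq> {}" "B \<noteq> {}"
    unfolding separation_def by blast+
  have "anticomplete E (f ` C) (f ` D)" if "anticomplete ?E C D" "C \<subseteq> U" "D \<subseteq> U" for C D
  proof -
    have "(f a, f b) \<notin> E" if "a \<in> C" "b \<in> D" for a b
      using anticompleteD[OF \<open>anticomplete ?E C D\<close> that] that \<open>C \<subseteq> U\<close> \<open>D \<subseteq> U\<close> by auto
    then show ?thesis
      by (simp add: anticomplete_def)
  qed
  then have "anticomplete E (f ` A) (f ` B)" "independent E (f ` (U - (A \<union> B)))"
    using AB unfolding separation_def by blast+
  moreover have "f ` A \<inter> f ` B = {}" "f ` U - (f ` A \<union> f ` B) = f ` (U - (A \<union> B))"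
    using sides inj_on_image_Int[OF inj, of A B] inj_on_image_set_diff[OF inj, of U "A \<union> B"]
    by (simp_all add: image_Un)
  ultimately have "separation (f ` U) E (f ` A) (f ` B)"
    using sides by (simp add: separation_def image_mono)
  then show "separable (f ` U) E"
    unfolding separable_def by blast
qed

lemma has_stable_cutset_pullback_iff:
  assumes "pair_graph (pullback f U G)" and "inj_on f U"
  shows "has_stable_cutset (pullback f U G) \<longleftrightarrow> separable (f ` U) (parcs G)"
  using has_stable_cutset_iff_separable[OF assms(1)] separable_inj_image_iff[OF assms(2)]
  by (simp add: pullback_def)

section \<open>Kernels of a separation problem\<close>

definition triangle_free :: "('a \<times> 'a) set \<Rightarrow> 'a set \<Rightarrow> bool" where
  "triangle_free E N \<longleftrightarrow> \<not> (\<exists>a\<in>N. \<exists>b\<in>N. \<exists>c\<in>N. (a, b) \<in> E \<and> (a, c) \<in> E \<and> (b, c) \<in> E)"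

lemma triangle_free_mono: "triangle_free E N \<Longrightarrow> M \<subseteq> N \<Longrightarrow> triangle_free E M"
  unfolding triangle_free_def by blast

lemma independent_imp_triangle_free: "independent E N \<Longrightarrow> triangle_free E N"
  unfolding triangle_free_def anticomplete_def by blast

text \<open>When non-adjacency is an equivalence relation on \<open>N\<close>, this says that \<open>R\<close> meets every class
  of \<open>N\<close>, or at least three of them.\<close>

definition represents :: "('a \<times> 'a) set \<Rightarrow> 'a set \<Rightarrow> 'a set \<Rightarrow> bool" where
  "represents E R N \<longleftrightarrow>
     (\<forall>v\<in>N. \<exists>w\<in>R \<inter> N. (v, w) \<notin> E) \<or> \<not> triangle_free E (R \<inter> N)"

lemma represents_mono: "represents E R N \<Longrightarrow> R \<subseteq> R' \<Longrightarrow> represents E R' N"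
  unfolding represents_def triangle_free_def by blast

definition common_neighbours :: "('a \<times> 'a) set \<Rightarrow> 'a set \<Rightarrow> 'a set \<Rightarrow> 'a set" where
  "common_neighbours E N Y = {v \<in> N. \<forall>x\<in>Y. (x, v) \<in> E}"

locale co_cluster_kernel = co_cluster_modulator V E X
  for V :: "'a set" and E X +
  fixes K :: "'a set"
  assumes X_subset_K: "X \<subseteq> K"
    and K_subset: "K \<subseteq> V"
    and represents_common_neighbours:
      "\<lbrakk>Y \<subseteq> X; card Y \<le> 3\<rbrakk> \<Longrightarrow> represents E K (common_neighbours E (V - X) Y)"
    and independent_neighbourhood_kept:
      "\<exists>v\<in>V. independent E (E `` {v}) \<Longrightarrow> \<exists>v\<in>K. independent E (E `` {v})"
    and K_large: "K = V \<or> 3 \<le> card K"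
begin

definition outer_neighbours :: "'a set \<Rightarrow> 'a set" where
  "outer_neighbours U = {v \<in> V - K. \<exists>x\<in>U. (x, v) \<in> E}"

lemma anticomplete_not_outer_neighbours: "anticomplete E (V - K - outer_neighbours U) U"
  using adjacent_sym by (auto simp: anticomplete_def outer_neighbours_def)

lemma representative:
  assumes v: "v \<in> V - K" and Y: "Y \<subseteq> K" "card Y \<le> 3" "\<And>y. y \<in> Y \<Longrightarrow> (y, v) \<in> E"
    and no_triangle: "triangle_free E (K \<inter> common_neighbours E (V - X) (Y \<inter> X))"
  obtains w where "w \<in> K - X" and "(v, w) \<notin> E" and "\<And>y. y \<in> Y \<Longrightarrow> (y, w) \<in> E"
proof -
  let ?N = "common_neighbours E (V - X) (Y \<inter> X)"
  have "finite Y"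
    using Y(1) K_subset finite_V finite_subset by metis
  then have "card (Y \<inter> X) \<le> 3"
    using card_mono[of Y "Y \<inter> X"] Y(2) by simp
  then have "represents E K ?N"
    by (simp add: represents_common_neighbours)
  moreover have "v \<in> ?N"
    using v Y(3) X_subset_K by (auto simp: common_neighbours_def)
  ultimately obtain w where w: "w \<in> K" "w \<in> ?N" "(v, w) \<notin> E"
    using no_triangle unfolding represents_def by blast
  have "(y, w) \<in> E" if "y \<in> Y" for y
  proof (cases "y \<in> X")
    case True
    with w(2) that show ?thesis
      by (simp add: common_neighbours_def)
  next
    case False
    \<comment> \<open>Adjacency to \<open>y \<notin> X\<close> depends only on the part, which \<open>v\<close> and \<open>w\<close> share.\<close>
    then have "y \<in> V - X" "v \<in> V - X" "w \<in> V - X"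
      using that Y(1) K_subset v X_subset_K w(2) by (auto simp: common_neighbours_def)
    then show ?thesis
      using nonadjacent_trans[of y w v] w(3) Y(3)[OF that] adjacent_sym by blast
  qed
  with w that show thesis
    by (auto simp: common_neighbours_def)
qed

end

locale separated_kernel = co_cluster_kernel +
  fixes A B
  assumes separation: "separation K E A B"
begin

abbreviation S :: "'a set" where
  "S \<equiv> K - (A \<union> B)"

lemma A_subset: "A \<subseteq> K" and B_subset: "B \<subseteq> K" and disjoint_A_B: "A \<inter> B = {}"
  and A_nonempty: "A \<noteq> {}" and B_nonempty: "B \<noteq> {}"
  and anticomplete_A_B: "anticomplete E A B" and independent_S: "independent E S"
  using separation unfolding separation_def by blast+

lemma anticomplete_B_A: "anticomplete E B A"
  using anticomplete_sym[OF sym_E anticomplete_A_B] .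

lemma separated_kernel_sym: "separated_kernel V E X K B A"
  using separation_sym[OF sym_E separation] by unfold_locales

text \<open>If one side lies in \<open>X\<close>, a deleted vertex joins the cutset when it has a neighbour on that
  side, and the other side otherwise.\<close>

context
  assumes B_subset_X: "B \<subseteq> X"
begin

lemma representative_in_S:
  assumes v: "v \<in> outer_neighbours B" and y: "y \<in> K" "(y, v) \<in> E"
  obtains w where "w \<in> S - X" and "(v, w) \<notin> E" and "(y, w) \<in> E"
proof -
  obtain b where b: "b \<in> B" "(b, v) \<in> E" and "v \<in> V - K"
    using v by (auto simp: outer_neighbours_def)
  have in_S: "w \<in> S" if "w \<in> K - X" "(b, w) \<in> E" for w
    using that b(1) B_subset_X anticompleteD[OF anticomplete_B_A] by blast
  have "K \<inter> common_neighbours E (V - X) ({b, y} \<inter> X) \<subseteq> S"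
    using in_S b(1) B_subset_X by (auto simp: common_neighbours_def)
  then have "triangle_free E (K \<inter> common_neighbours E (V - X) ({b, y} \<inter> X))"
    using independent_S independent_imp_triangle_free triangle_free_mono by blast
  moreover have "card {b, y} \<le> 3" "{b, y} \<subseteq> K"
    using card_insert_le_m1[of 3 "{y}" b] b(1) y(1) B_subset by auto
  ultimately obtain w where "w \<in> K - X" "(v, w) \<notin> E" "\<And>x. x \<in> {b, y} \<Longrightarrow> (x, w) \<in> E"
    using representative[OF \<open>v \<in> V - K\<close>, of "{b, y}"] b(2) y(2) by blast
  then show thesis
    using in_S that by blast
qed

lemma anticomplete_outer_neighbours_S: "anticomplete E (outer_neighbours B) S"
  unfolding anticomplete_def
proof (intro ballI notI)
  fix v s
  assume "v \<in> outer_neighbours B" "s \<in> S" "(v, s) \<in> E"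
  then obtain w where "w \<in> S" "(s, w) \<in> E"
    using representative_in_S[of v s] adjacent_sym by blast
  with \<open>s \<in> S\<close> show False
    using anticompleteD[OF independent_S] by blast
qed

lemma independent_outer_neighbours: "independent E (outer_neighbours B)"
  unfolding anticomplete_def
proof (intro ballI notI)
  fix u v
  assume uv: "u \<in> outer_neighbours B" "v \<in> outer_neighbours B" "(u, v) \<in> E"
  then obtain b where "b \<in> B" "(b, v) \<in> E"
    by (auto simp: outer_neighbours_def)
  then obtain w where w: "w \<in> S - X" "(v, w) \<notin> E"
    using representative_in_S[OF uv(2), of b] B_subset by blast
  have "(u, w) \<notin> E"
    using anticompleteD[OF anticomplete_outer_neighbours_S uv(1)] w(1) by blast
  then show False
    using nonadjacent_trans[of u w v] uv w K_subset X_subset_K adjacent_sym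
    unfolding outer_neighbours_def by blast
qed

lemma separable_if_B_subset_X: "separable V E"
proof -
  let ?N = "outer_neighbours B"
  let ?A = "A \<union> (V - K - ?N)"
  have "V - (?A \<union> B) = S \<union> ?N"
    using A_subset B_subset K_subset by (auto simp: outer_neighbours_def)
  moreover have "anticomplete E (V - K - ?N) B"
    by (rule anticomplete_not_outer_neighbours)
  moreover have "anticomplete E S ?N"
    using anticomplete_sym[OF sym_E anticomplete_outer_neighbours_S] .
  moreover have "?A \<subseteq> V" "B \<subseteq> V" "?A \<inter> B = {}" "?A \<noteq> {}"
    using A_subset B_subset K_subset disjoint_A_B A_nonempty by auto
  ultimately have "separation V E ?A B"
    using anticomplete_outer_neighbours_S independent_outer_neighbours independent_S
      anticomplete_A_B B_nonempty
    by (simp add: separation_def anticomplete_Un_left anticomplete_Un_right)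
  then show ?thesis
    unfolding separable_def by blast
qed

end

text \<open>If both sides meet \<open>V - X\<close>, they do so in one and the same part, and the rest of \<open>K - X\<close>
  lies in the cutset and hence in a second part.\<close>

context
  fixes a b
  assumes a: "a \<in> A - X" and b: "b \<in> B - X"
begin

lemma adjacent_both_iff:
  assumes "w \<in> V - X"
  shows "(a, w) \<in> E \<longleftrightarrow> (b, w) \<in> E"
proof -
  have "a \<in> V - X" "b \<in> V - X"
    using a b A_subset B_subset K_subset by auto
  moreover have "(a, b) \<notin> E" "(b, a) \<notin> E"
    using a b anticompleteD[OF anticomplete_A_B] anticompleteD[OF anticomplete_B_A] by auto
  ultimately show ?thesis
    using nonadjacent_trans[of a b w] nonadjacent_trans[of b a w] assms by blast
qed

lemma adjacent_in_S:
  assumes "w \<in> K - X" and "(a, w) \<in> E"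
  shows "w \<in> S"
proof -
  have "(b, w) \<in> E"
    using adjacent_both_iff[of w] assms K_subset by blast
  then have "w \<notin> A" "w \<notin> B"
    using assms(2) a b anticompleteD[OF anticomplete_A_B, of a w]
      anticompleteD[OF anticomplete_B_A, of b w] by blast+
  with assms(1) show ?thesis
    by blast
qed

lemma triangle_free_kept: "triangle_free E (K - X)"
  unfolding triangle_free_def
proof (intro notI, elim bexE conjE)
  fix u v w
  assume K: "u \<in> K - X" "v \<in> K - X" "w \<in> K - X" and E: "(u, v) \<in> E" "(u, w) \<in> E" "(v, w) \<in> E"
  have split: "(a, x) \<in> E \<or> (a, y) \<in> E" if "x \<in> K - X" "y \<in> K - X" "(x, y) \<in> E" for x y
    using nonadjacent_trans[of x a y] adjacent_sym[of x a] that a A_subset K_subset by blast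
  have not_both: "\<not> ((a, x) \<in> E \<and> (a, y) \<in> E)" if "x \<in> K - X" "y \<in> K - X" "(x, y) \<in> E" for x y
    using adjacent_in_S[of x] adjacent_in_S[of y] anticompleteD[OF independent_S, of x y] that
    by blast
  show False
    using split[OF K(1,2) E(1)] split[OF K(1,3) E(2)] split[OF K(2,3) E(3)]
      not_both[OF K(1,2) E(1)] not_both[OF K(1,3) E(2)] not_both[OF K(2,3) E(3)] by blast
qed

lemma anticomplete_both_outer_neighbours_S:
  "anticomplete E (outer_neighbours A \<inter> outer_neighbours B) S"
  unfolding anticomplete_def
proof (intro ballI notI)
  fix v s
  assume v: "v \<in> outer_neighbours A \<inter> outer_neighbours B" and s: "s \<in> S" "(v, s) \<in> E"
  then obtain p q where pq: "p \<in> A" "(p, v) \<in> E" "q \<in> B" "(q, v) \<in> E" and "v \<in> V - K"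
    by (auto simp: outer_neighbours_def)
  have adj: "(y, v) \<in> E" if "y \<in> {p, q, s}" for y
    using that pq adjacent_sym[OF s(2)] by blast
  have "card {p, q, s} \<le> 3"
    by (auto simp: card_insert_if)
  moreover have "{p, q, s} \<subseteq> K"
    using pq s A_subset B_subset by auto
  moreover have "triangle_free E (K \<inter> common_neighbours E (V - X) ({p, q, s} \<inter> X))"
    by (rule triangle_free_mono[OF triangle_free_kept]) (auto simp: common_neighbours_def)
  ultimately obtain w where w: "w \<in> K - X" and E: "\<And>y. y \<in> {p, q, s} \<Longrightarrow> (y, w) \<in> E"
    using representative[OF \<open>v \<in> V - K\<close> _ _ adj] by metis
  have "(p, w) \<in> E" "(q, w) \<in> E" "(s, w) \<in> E"
    using E by simp_all
  then have "w \<notin> B" "w \<notin> A" "w \<notin> S"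
    using anticompleteD[OF anticomplete_A_B pq(1)] anticompleteD[OF anticomplete_B_A pq(3)]
      anticompleteD[OF independent_S s(1)] by blast+
  with w show False
    by blast
qed

lemma outer_neighbours_of_edge:
  assumes "u \<in> V - K" "v \<in> V - K" and "(u, v) \<in> E"
  shows "u \<in> outer_neighbours A \<inter> outer_neighbours B \<longleftrightarrow> v \<notin> outer_neighbours A \<inter> outer_neighbours B"
proof -
  let ?N = "outer_neighbours A \<inter> outer_neighbours B"
  have exactly_first: "u \<in> ?N \<and> v \<notin> ?N"
    if uv: "u \<in> V - K" "v \<in> V - K" "(u, v) \<in> E" and au: "(a, u) \<in> E" for u v
  proof -
    have "(b, u) \<in> E"
      using adjacent_both_iff[of u] uv(1) au X_subset_K by blast
    then have "u \<in> ?N"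
      using au a b uv(1) by (auto simp: outer_neighbours_def)
    have "triangle_free E (K \<inter> common_neighbours E (V - X) ({a} \<inter> X))"
      by (rule triangle_free_mono[OF triangle_free_kept]) (auto simp: common_neighbours_def)
    then obtain w where w: "w \<in> K - X" "(u, w) \<notin> E" "(a, w) \<in> E"
      using representative[OF uv(1), of "{a}"] a au A_subset by auto
    have "(v, w) \<in> E"
      using nonadjacent_trans[of u w v] w uv adjacent_sym K_subset X_subset_K by blast
    then have "v \<notin> ?N"
      using anticompleteD[OF anticomplete_both_outer_neighbours_S] adjacent_in_S[OF w(1,3)] by blast
    with \<open>u \<in> ?N\<close> show ?thesis
      by blast
  qed
  have "(a, u) \<in> E \<or> (a, v) \<in> E"
    using nonadjacent_trans[of u a v] adjacent_sym[of u a] assms a A_subset K_subset X_subset_K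
    by blast
  then show ?thesis
    using exactly_first[OF assms] exactly_first[OF assms(2,1) adjacent_sym[OF assms(3)]] by blast
qed

lemma separable_if_both_sides_meet: "separable V E"
proof -
  define N\<^sub>A N\<^sub>B where "N\<^sub>A = outer_neighbours A" and "N\<^sub>B = outer_neighbours B"
  let ?A = "A \<union> (V - K - N\<^sub>B)" and ?B = "B \<union> (N\<^sub>B - N\<^sub>A)"
  have N: "N\<^sub>A \<subseteq> V - K" "N\<^sub>B \<subseteq> V - K"
    by (auto simp: N\<^sub>A_def N\<^sub>B_def outer_neighbours_def)
  have "V - (?A \<union> ?B) = S \<union> (N\<^sub>A \<inter> N\<^sub>B)"
    using A_subset B_subset K_subset N by blast
  moreover have "?A \<subseteq> V" "?B \<subseteq> V" "?A \<inter> ?B = {}" "?A \<noteq> {}" "?B \<noteq> {}"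
    using A_subset B_subset K_subset N disjoint_A_B A_nonempty B_nonempty by auto
  moreover have "anticomplete E (N\<^sub>A \<inter> N\<^sub>B) S"
    unfolding N\<^sub>A_def N\<^sub>B_def by (rule anticomplete_both_outer_neighbours_S)
  moreover from this have "anticomplete E S (N\<^sub>A \<inter> N\<^sub>B)"
    by (rule anticomplete_sym[OF sym_E])
  moreover have "independent E (N\<^sub>A \<inter> N\<^sub>B)" "anticomplete E (V - K - N\<^sub>B) (N\<^sub>B - N\<^sub>A)"
    using outer_neighbours_of_edge N unfolding anticomplete_def N\<^sub>A_def N\<^sub>B_def by blast+
  moreover have "anticomplete E (V - K - N\<^sub>B) B"
    unfolding N\<^sub>B_def by (rule anticomplete_not_outer_neighbours)
  moreover have "anticomplete E A (N\<^sub>B - N\<^sub>A)"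
    using N by (auto simp: anticomplete_def N\<^sub>A_def outer_neighbours_def)
  ultimately have "separation V E ?A ?B"
    using independent_S anticomplete_A_B
    by (simp add: separation_def anticomplete_Un_left anticomplete_Un_right)
  then show ?thesis
    unfolding separable_def by blast
qed

end

lemma separable_extend: "separable V E"
proof (cases "A \<subseteq> X \<or> B \<subseteq> X")
  case True
  then show ?thesis
    using separable_if_B_subset_X separated_kernel.separable_if_B_subset_X[OF separated_kernel_sym]
    by blast
next
  case False
  then show ?thesis
    using separable_if_both_sides_meet by blast
qed

end

lemma separable_if_independent_neighbourhood:
  assumes "irrefl E" and v: "v \<in> U" "independent E (E `` {v})" and U: "finite U" "3 \<le> card U"
  shows "separable U E"
proof (cases "\<exists>u\<in>U - {v}. (v, u) \<notin> E")
  case True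
  then have "separation U E {v} {u \<in> U - {v}. (v, u) \<notin> E}"
    using v by (auto simp: separation_def anticomplete_def)
  then show ?thesis
    unfolding separable_def by blast
next
  case False
  have "2 \<le> card (U - {v})"
    using U v(1) by simp
  then obtain a b where ab: "a \<in> U - {v}" "b \<in> U - {v}" "a \<noteq> b"
    by (metis U(1) card_le_Suc0_iff_eq finite_Diff not_less_eq_eq numeral_2_eq_2)
  have "U - ({a} \<union> (U - {v, a})) = {v}"
    using v(1) ab by auto
  moreover have "anticomplete E {a} (U - {v, a})"
    using v(2) False ab(1) by (auto simp: anticomplete_def)
  moreover have "independent E {v}"
    using assms(1) by (simp add: anticomplete_def irrefl_def)
  ultimately have "separation U E {a} (U - {v, a})"
    using ab by (auto simp: separation_def)
  then show ?thesis
    unfolding separable_def by blast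
qed

context co_cluster_kernel
begin

lemma separation_side_contains_edge:
  assumes sep: "separation V E A B" and a: "a \<in> A" "\<not> independent E (E `` {a})"
  obtains c where "c \<in> A" and "(a, c) \<in> E"
proof -
  have AB: "anticomplete E A B" "independent E (V - (A \<union> B))"
    using sep unfolding separation_def by blast+
  obtain u w where uw: "(a, u) \<in> E" "(a, w) \<in> E" "(u, w) \<in> E"
    using a(2) by (auto simp: anticomplete_def)
  then have "u \<notin> B" "w \<notin> B" "u \<in> V" "w \<in> V"
    using anticompleteD[OF AB(1) a(1)] E_subset by blast+
  then have "u \<in> A \<or> w \<in> A"
    using anticompleteD[OF AB(2), of u w] uw(3) by blast
  with uw that show thesis
    by blast
qed

lemma edge_representative:
  assumes "(a, c) \<in> E" and ac: "a \<in> V - X" "c \<in> V - X"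
  obtains u w where "u \<in> K - X" and "w \<in> K - X" and "(u, w) \<in> E"
proof -
  have "common_neighbours E (V - X) {} = V - X"
    by (auto simp: common_neighbours_def)
  then have "represents E K (V - X)"
    using represents_common_neighbours[of "{}"] by simp
  then consider
      (classes) "\<forall>v\<in>V - X. \<exists>w\<in>K \<inter> (V - X). (v, w) \<notin> E"
    | (triangle) "\<not> triangle_free E (K \<inter> (V - X))"
    unfolding represents_def by blast
  then show thesis
  proof cases
    case classes
    then obtain u w where uw: "u \<in> K \<inter> (V - X)" "w \<in> K \<inter> (V - X)" "(a, u) \<notin> E" "(c, w) \<notin> E"
      using ac by meson
    then have "(u, w) \<in> E"
      using nonadjacent_trans[of a u w] nonadjacent_trans[of a w c] assms adjacent_sym[of w c]
      by blast
    with uw that show thesis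
      by blast
  next
    case triangle
    with that show thesis
      unfolding triangle_free_def by blast
  qed
qed

lemma separation_meets_kernel:
  assumes sep: "separation V E A B" and A_X: "A \<inter> X = {}"
    and no_independent: "\<And>v. v \<in> V \<Longrightarrow> \<not> independent E (E `` {v})"
  shows "A \<inter> K \<noteq> {}" and "B \<inter> K \<noteq> {}"
proof -
  have AB: "A \<subseteq> V" "B \<subseteq> V" "A \<noteq> {}" "B \<noteq> {}" "anticomplete E A B" "independent E (V - (A \<union> B))"
    using sep unfolding separation_def by blast+
  then obtain a c where ac: "a \<in> A" "c \<in> A" "(a, c) \<in> E"
    using separation_side_contains_edge[OF sep] no_independent by (metis all_not_in_conv subsetD)
  then have ac_X: "a \<in> V - X" "c \<in> V - X"
    using AB(1) A_X by blast+
  have B_X: "B \<subseteq> X"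
  proof
    fix h
    assume h: "h \<in> B"
    then have "(a, h) \<notin> E" "(h, c) \<notin> E"
      using ac anticompleteD[OF AB(5)] adjacent_sym by blast+
    then show "h \<in> X"
      using nonadjacent_trans[of a h c] ac_X ac(3) h AB(2) by blast
  qed
  then show "B \<inter> K \<noteq> {}"
    using AB(4) X_subset_K by blast
  obtain u w where "u \<in> K - X" "w \<in> K - X" "(u, w) \<in> E"
    using edge_representative[OF ac(3) ac_X] by blast
  then have "u \<in> A \<or> w \<in> A"
    using anticompleteD[OF AB(6), of u w] B_X K_subset by blast
  with \<open>u \<in> K - X\<close> \<open>w \<in> K - X\<close> show "A \<inter> K \<noteq> {}"
    by blast
qed

lemma separable_restrict:
  assumes "separable V E"
  shows "separable K E"
proof (cases "\<exists>v\<in>V. independent E (E `` {v})")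
  case True
  then show ?thesis
    using independent_neighbourhood_kept K_large assms finite_subset[OF K_subset finite_V]
      separable_if_independent_neighbourhood[OF irrefl_E, of _ K] by metis
next
  case False
  obtain A B where AB: "separation V E A B"
    using assms unfolding separable_def by blast
  have "A \<inter> K \<noteq> {} \<and> B \<inter> K \<noteq> {}"
  proof (cases "A \<inter> X = {} \<or> B \<inter> X = {}")
    case True
    then show ?thesis
      using separation_meets_kernel[OF AB] separation_meets_kernel[OF separation_sym[OF sym_E AB]]
        False by blast
  qed (use X_subset_K in blast)
  then have "separation K E (A \<inter> K) (B \<inter> K)"
    using separation_restrict[OF AB K_subset] by blast
  then show ?thesis
    unfolding separable_def by blast
qed

theorem separable_kernel_iff: "separable K E \<longleftrightarrow> separable V E"
proof
  assume "separable K E"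
  then obtain A B where "separation K E A B"
    unfolding separable_def by blast
  then interpret separated_kernel V E X K A B
    by unfold_locales
  show "separable V E"
    by (rule separable_extend)
qed (rule separable_restrict)

end

section \<open>A kernel of cubic size\<close>

definition smallest :: "nat \<Rightarrow> 'a::linorder set \<Rightarrow> 'a set" where
  "smallest k N = {v \<in> N. card {w \<in> N. w < v} < k}"

definition class_leaders :: "('a \<times> 'a) set \<Rightarrow> 'a::linorder set \<Rightarrow> 'a set" where
  "class_leaders E N = {v \<in> N. \<forall>w\<in>N. w < v \<longrightarrow> (w, v) \<in> E}"

lemma smallest_subset: "smallest k N \<subseteq> N"
  by (auto simp: smallest_def)

lemma card_smallest_le:
  assumes "finite N"
  shows "card (smallest k N) \<le> k"
proof -
  let ?rank = "\<lambda>v. card {w \<in> N. w < v}"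
  have rank_less: "?rank u < ?rank v" if "u \<in> N" "u < v" for u v
    using assms that by (intro psubset_card_mono) (auto intro: less_trans)
  have "inj_on ?rank (smallest k N)"
  proof (rule linorder_inj_onI)
    fix u v
    assume "u < v" "u \<in> smallest k N" "v \<in> smallest k N"
    then show "?rank u \<noteq> ?rank v"
      using rank_less[of u v] smallest_subset[of k N] by auto
  qed auto
  moreover have "?rank ` smallest k N \<subseteq> {..<k}"
    by (auto simp: smallest_def)
  ultimately show ?thesis
    using card_inj_on_le[of ?rank "smallest k N" "{..<k}"] by simp
qed

lemma smallest_eq_or_card_ge:
  assumes "finite N"
  shows "smallest k N = N \<or> k \<le> card (smallest k N)"
proof (cases "smallest k N = N")
  case False
  define v where "v = Min (N - smallest k N)"
  have "N - smallest k N \<noteq> {}" "finite (N - smallest k N)"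
    using False smallest_subset assms by blast+
  then have v: "v \<in> N - smallest k N" and v_min: "\<And>w. w \<in> N - smallest k N \<Longrightarrow> v \<le> w"
    unfolding v_def using Min_in Min_le by blast+
  have "k \<le> card {w \<in> N. w < v}"
    using v by (auto simp: smallest_def)
  also have "\<dots> \<le> card (smallest k N)"
  proof (rule card_mono)
    show "finite (smallest k N)"
      using assms smallest_subset finite_subset by blast
    show "{w \<in> N. w < v} \<subseteq> smallest k N"
      using v_min by force
  qed
  finally show ?thesis
    by simp
qed simp

lemma adjacent_class_leaders:
  assumes "sym E" and "u \<in> class_leaders E N" and "v \<in> class_leaders E N" and "u \<noteq> v"
  shows "(u, v) \<in> E"
  using assms by (cases u v rule: linorder_cases) (auto simp: class_leaders_def dest: symD)

lemma nonadjacent_class_leader: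
  assumes "finite N" and "sym E" and "irrefl E" and trans: "trans (nonadjacency E N)" and v: "v \<in> N"
  obtains w where "w \<in> class_leaders E N" and "(v, w) \<notin> E"
proof -
  define w where "w = Min {w \<in> N. (v, w) \<notin> E}"
  have "v \<in> {w \<in> N. (v, w) \<notin> E}"
    using v \<open>irrefl E\<close> by (auto simp: irrefl_def)
  then have w: "w \<in> N" "(v, w) \<notin> E" and w_min: "\<And>u. u \<in> N \<Longrightarrow> (v, u) \<notin> E \<Longrightarrow> w \<le> u"
    using Min_in[of "{w \<in> N. (v, w) \<notin> E}"] \<open>finite N\<close> unfolding w_def by auto
  have "(u, w) \<in> E" if u: "u \<in> N" "u < w" for u
  proof (rule ccontr)
    assume "(u, w) \<notin> E"
    then have "(v, u) \<notin> E"
      using transD[OF trans, of v w u] \<open>sym E\<close> v w u(1) by (auto simp: nonadjacency_def dest: symD)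
    then show False
      using w_min u by fastforce
  qed
  with w that show thesis
    by (auto simp: class_leaders_def)
qed

lemma represents_smallest_class_leaders:
  assumes "finite N" and "sym E" and "irrefl E" and "trans (nonadjacency E N)"
  shows "represents E (smallest 3 (class_leaders E N)) N"
proof -
  let ?L = "class_leaders E N"
  have L: "?L \<subseteq> N" "finite ?L"
    using \<open>finite N\<close> by (auto simp: class_leaders_def)
  from smallest_eq_or_card_ge[OF L(2), of 3] show ?thesis
  proof
    assume "smallest 3 ?L = ?L"
    then show ?thesis
      using nonadjacent_class_leader[OF assms] L(1) unfolding represents_def
      by (metis Int_iff subsetD)
  next
    assume "3 \<le> card (smallest 3 ?L)"
    then obtain T where "T \<subseteq> smallest 3 ?L" "card T = 3"
      by (rule obtain_subset_with_card_n)
    then obtain x y z where xyz: "x \<in> smallest 3 ?L" "y \<in> smallest 3 ?L" "z \<in> smallest 3 ?L"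
      and distinct: "x \<noteq> y" "x \<noteq> z" "y \<noteq> z"
      by (auto simp: card_3_iff)
    then have "x \<in> ?L" "y \<in> ?L" "z \<in> ?L"
      using smallest_subset by blast+
    with xyz distinct show ?thesis
      using adjacent_class_leaders[OF \<open>sym E\<close>] L(1) unfolding represents_def triangle_free_def
      by blast
  qed
qed

definition cutset_kernel :: "'a::linorder set \<Rightarrow> ('a \<times> 'a) set \<Rightarrow> 'a set \<Rightarrow> 'a set" where
  "cutset_kernel V E X = X \<union> smallest 3 V \<union> smallest 3 {v \<in> V. independent E (E `` {v})} \<union>
     (\<Union>Y\<in>{Y. Y \<subseteq> X \<and> card Y \<le> 3}. smallest 3 (class_leaders E (common_neighbours E (V - X) Y)))"

lemma subsets_card_le_3:
  assumes "finite X"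
  shows "{Y. Y \<subseteq> X \<and> card Y \<le> 3} = insert {} ((\<lambda>(x, y, z). {x, y, z}) ` (X \<times> X \<times> X))"
proof (intro equalityI subsetI)
  fix Y
  assume "Y \<in> {Y. Y \<subseteq> X \<and> card Y \<le> 3}"
  then have Y: "Y \<subseteq> X" "finite Y" "card Y \<le> 3"
    using assms finite_subset by auto
  then have "card Y = 0 \<or> card Y = 1 \<or> card Y = 2 \<or> card Y = 3"
    by linarith
  then have "Y = {} \<or> (\<exists>x y z. Y = {x, y, z})"
    using Y(2) unfolding One_nat_def card_1_singleton_iff card_2_iff card_3_iff
    by (metis card_0_eq insert_absorb2)
  with Y(1) show "Y \<in> insert {} ((\<lambda>(x, y, z). {x, y, z}) ` (X \<times> X \<times> X))"
    by (auto simp: image_iff)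
qed (auto simp: card_insert_if)

lemma cutset_kernel_eq:
  assumes "finite X"
  shows "cutset_kernel V E X = X \<union> smallest 3 V \<union> smallest 3 {v \<in> V. independent E (E `` {v})} \<union>
    smallest 3 (class_leaders E (V - X)) \<union>
    (\<Union>x\<in>X. \<Union>y\<in>X. \<Union>z\<in>X.
      smallest 3 (class_leaders E ((V - X) \<inter> (E `` {x} \<inter> (E `` {y} \<inter> E `` {z})))))"
proof -
  have "common_neighbours E (V - X) {x, y, z} = (V - X) \<inter> (E `` {x} \<inter> (E `` {y} \<inter> E `` {z}))"
    for x y z
    by (auto simp: common_neighbours_def)
  moreover have "common_neighbours E (V - X) {} = V - X"
    by (auto simp: common_neighbours_def)
  ultimately show ?thesis
    unfolding cutset_kernel_def subsets_card_le_3[OF assms(1)] by (simp add: Un_assoc Sigma_def)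
qed

lemma card_cutset_kernel_le:
  assumes "finite V" and "X \<subseteq> V"
  shows "card (cutset_kernel V E X) \<le> card X + 9 + 3 * card X ^ 3"
proof -
  let ?Ys = "{Y. Y \<subseteq> X \<and> card Y \<le> 3}"
  let ?R = "\<lambda>Y. smallest 3 (class_leaders E (common_neighbours E (V - X) Y))"
  let ?A = "smallest 3 V" and ?B = "smallest 3 {v \<in> V. independent E (E `` {v})}"
  have "finite X"
    using assms finite_subset by blast
  have "card ?Ys \<le> Suc (card ((\<lambda>(x, y, z). {x, y, z}) ` (X \<times> X \<times> X)))"
    unfolding subsets_card_le_3[OF \<open>finite X\<close>] by (rule card_insert_le_m1) simp_all
  also have "card ((\<lambda>(x, y, z). {x, y, z}) ` (X \<times> X \<times> X)) \<le> card X ^ 3"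
    using card_image_le[of "X \<times> X \<times> X" "\<lambda>(x, y, z). {x, y, z}"] \<open>finite X\<close>
    by (simp add: card_cartesian_product power3_eq_cube)
  finally have "card ?Ys \<le> Suc (card X ^ 3)"
    by simp
  moreover have "card (\<Union>Y\<in>?Ys. ?R Y) \<le> (\<Sum>Y\<in>?Ys. card (?R Y))"
    using \<open>finite X\<close> by (intro card_UN_le) simp
  moreover have "(\<Sum>Y\<in>?Ys. card (?R Y)) \<le> (\<Sum>Y\<in>?Ys. 3)"
    using \<open>finite V\<close>
    by (intro sum_mono card_smallest_le) (simp add: class_leaders_def common_neighbours_def)
  ultimately have "card (\<Union>Y\<in>?Ys. ?R Y) \<le> 3 * Suc (card X ^ 3)"
    by simp
  moreover have "card ?A \<le> 3" "card ?B \<le> 3"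
    using \<open>finite V\<close> by (simp_all add: card_smallest_le)
  moreover have "card (cutset_kernel V E X) \<le> card X + card ?A + card ?B + card (\<Union>Y\<in>?Ys. ?R Y)"
    unfolding cutset_kernel_def by (meson add_right_mono card_Un_le order_trans)
  ultimately show ?thesis
    by simp
qed

lemma card_cutset_kernel_le_cubic:
  assumes "finite V" and "X \<subseteq> V"
  shows "card (cutset_kernel V E X) \<le> 13 * card X ^ 3 \<or> card (cutset_kernel V E X) \<le> 9"
proof (cases "card X = 0")
  case True
  then show ?thesis
    using card_cutset_kernel_le[OF assms, of E] by simp
next
  case False
  then have "1 \<le> card X ^ 3" "card X \<le> card X ^ 3"
    by (simp_all add: Suc_leI self_le_power)
  then show ?thesis
    using card_cutset_kernel_le[OF assms, of E] by linarith
qed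

lemma cutset_kernel_subset: "X \<subseteq> V \<Longrightarrow> cutset_kernel V E X \<subseteq> V"
  using smallest_subset[of 3] unfolding cutset_kernel_def class_leaders_def common_neighbours_def
  by blast

lemma represents_cutset_kernel:
  assumes "co_cluster_modulator V E X" and "Y \<subseteq> X" "card Y \<le> 3"
  shows "represents E (cutset_kernel V E X) (common_neighbours E (V - X) Y)"
proof -
  interpret co_cluster_modulator V E X
    by fact
  let ?N = "common_neighbours E (V - X) Y"
  have "finite ?N" "trans (nonadjacency E ?N)"
    using finite_V nonadjacent_trans
    unfolding trans_def nonadjacency_def common_neighbours_def by simp_all blast
  then have "represents E (smallest 3 (class_leaders E ?N)) ?N"
    using sym_E irrefl_E by (intro represents_smallest_class_leaders)
  then show ?thesis
    by (rule represents_mono) (use assms(2,3) in \<open>auto simp: cutset_kernel_def\<close>)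
qed

lemma co_cluster_kernel_cutset_kernel:
  assumes "co_cluster_modulator V E X"
  shows "co_cluster_kernel V E X (cutset_kernel V E X)"
proof -
  interpret co_cluster_modulator V E X
    by fact
  let ?K = "cutset_kernel V E X" and ?I = "{v \<in> V. independent E (E `` {v})}"
  have K_subset: "?K \<subseteq> V"
    using X_subset by (rule cutset_kernel_subset)
  then have "finite ?K"
    using finite_V finite_subset by blast
  show ?thesis
  proof
    show "X \<subseteq> ?K" "?K \<subseteq> V"
      using K_subset by (auto simp: cutset_kernel_def)
    show "represents E ?K (common_neighbours E (V - X) Y)" if "Y \<subseteq> X" "card Y \<le> 3" for Y
      using represents_cutset_kernel[OF assms that] .
    show "\<exists>v\<in>?K. independent E (E `` {v})" if "\<exists>v\<in>V. independent E (E `` {v})"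
    proof -
      have "smallest 3 ?I \<noteq> {}"
        using smallest_eq_or_card_ge[of ?I 3] finite_V that by auto
      then show ?thesis
        using smallest_subset[of 3 ?I] unfolding cutset_kernel_def by blast
    qed
    have "smallest 3 V \<subseteq> ?K"
      unfolding cutset_kernel_def by blast
    then show "?K = V \<or> 3 \<le> card ?K"
      using smallest_eq_or_card_ge[OF finite_V, of 3] card_mono[OF \<open>finite ?K\<close>, of "smallest 3 V"]
        K_subset by auto
  qed
qed

lemma has_stable_cutset_induced_cutset_kernel:
  assumes "mod_co_cluster_instance G X"
  defines "K \<equiv> cutset_kernel (pverts G) (parcs G) X"
  shows "mod_co_cluster_instance (induced K G) X"
    and "has_stable_cutset (induced K G) \<longleftrightarrow> has_stable_cutset G"
proof -
  interpret co_cluster_kernel "pverts G" "parcs G" X K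
    using assms(1) unfolding K_def mod_co_cluster_instance_iff
    by (rule co_cluster_kernel_cutset_kernel)
  show induced: "mod_co_cluster_instance (induced K G) X"
    using assms(1) X_subset_K K_subset by (rule mod_co_cluster_instance_induced)
  have "has_stable_cutset (induced K G) \<longleftrightarrow> separable K (parcs G)"
    using has_stable_cutset_pullback_iff[of "\<lambda>v. v" K G] induced
    by (simp add: mod_co_cluster_instance_def)
  also have "\<dots> \<longleftrightarrow> has_stable_cutset G"
    using has_stable_cutset_iff_separable[of G] assms(1) separable_kernel_iff
    by (simp add: mod_co_cluster_instance_def)
  finally show "has_stable_cutset (induced K G) \<longleftrightarrow> has_stable_cutset G" .
qed

section \<open>Time-bounded execution\<close>

definition runs :: "com \<Rightarrow> ram_state \<Rightarrow> nat \<Rightarrow> (ram_state \<Rightarrow> bool) \<Rightarrow> bool" where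
  "runs c s T Q \<longleftrightarrow> (\<exists>t s'. exec c s t s' \<and> t \<le> T \<and> Q s')"

abbreviation set_reg :: "nat \<Rightarrow> nat \<Rightarrow> ram_state \<Rightarrow> ram_state" where
  "set_reg i k s \<equiv> s\<lparr>reg := (reg s)(i := k)\<rparr>"

lemma runs_mono:
  "\<lbrakk>runs c s T Q; T \<le> T'; \<And>s'. Q s' \<Longrightarrow> Q' s'\<rbrakk> \<Longrightarrow> runs c s T' Q'"
  unfolding runs_def by (meson le_trans)

lemma runs_instr:
  assumes "0 < T"
  shows "Q (set_reg i k s) \<Longrightarrow> runs (Const i k) s T Q"
    and "Q (set_reg i (reg s j + reg s k) s) \<Longrightarrow> runs (Add i j k) s T Q"
    and "Q (set_reg i (reg s j - reg s k) s) \<Longrightarrow> runs (Sub i j k) s T Q"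
    and "Q (set_reg i (mem s (reg s j)) s) \<Longrightarrow> runs (Load i j) s T Q"
    and "Q (s\<lparr>out := out s @ [reg s i]\<rparr>) \<Longrightarrow> runs (Write i) s T Q"
  using assms unfolding runs_def less_eq_Suc_le One_nat_def[symmetric]
  by (blast intro: exec.intros)+

lemma runs_Seq: "runs c s T (\<lambda>s'. runs d s' U Q) \<Longrightarrow> runs (Seq c d) s (T + U) Q"
  unfolding runs_def by (meson add_mono exec.Seq)

lemma runs_If:
  "\<lbrakk>reg s i \<noteq> 0 \<Longrightarrow> runs c s T Q; reg s i = 0 \<Longrightarrow> runs d s U Q\<rbrakk> \<Longrightarrow> runs (If i c d) s (T + U + 1) Q"
  unfolding runs_def by (cases "reg s i = 0") (fastforce intro: exec.intros)+

lemma runs_While: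
  assumes "I k s"
    and "\<And>k s. I k s \<Longrightarrow> reg s i \<noteq> 0 \<Longrightarrow> runs c s T (\<lambda>s'. \<exists>j<k. I j s')"
  shows "runs (While i c) s (k * (T + 1) + 1) (\<lambda>s'. reg s' i = 0 \<and> (\<exists>j. I j s'))"
  using assms(1)
proof (induction k arbitrary: s rule: less_induct)
  case (less k)
  show ?case
  proof (cases "reg s i = 0")
    case True
    with less.prems show ?thesis
      unfolding runs_def
      by (intro exI[of _ 1] exI[of _ s]) (auto intro: exec.WhileFalse[simplified])
  next
    case False
    obtain t s' j where body: "exec c s t s'" "t \<le> T" and j: "j < k" "I j s'"
      using assms(2)[OF less.prems False] unfolding runs_def by blast
    obtain u s'' where rest: "exec (While i c) s' u s''" "u \<le> j * (T + 1) + 1"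
      and exit: "reg s'' i = 0" "\<exists>j. I j s''"
      using less.IH[OF j] unfolding runs_def by blast
    have "(j + 1) * (T + 1) \<le> k * (T + 1)"
      using j(1) by (intro mult_right_mono) auto
    then have "t + u + 1 \<le> k * (T + 1) + 1"
      using body(2) rest(2) by simp
    then show ?thesis
      unfolding runs_def using exec.WhileTrue[OF False body(1) rest(1)] exit by blast
  qed
qed

section \<open>Polynomial-time functions of an instance and some of its vertices\<close>

text \<open>Register 0 holds the number of vertices, register 1 the constant one, register 2 the value
  computed and register 3 the guard of the innermost loop; \<open>4 + 2 * i\<close> holds variable \<open>i\<close>, the
  loop variable of a loop at depth \<open>i\<close>, and \<open>5 + 2 * i\<close> the sum accumulated by that loop.\<close>

definition numbered_instance :: "nat pair_pre_digraph \<Rightarrow> nat set \<Rightarrow> bool" where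
  "numbered_instance G X \<longleftrightarrow> (\<exists>n. pverts G = {..<n}) \<and>
     parcs G \<subseteq> pverts G \<times> pverts G \<and> X \<subseteq> pverts G"

abbreviation encode_numbered :: "nat pair_pre_digraph \<Rightarrow> nat set \<Rightarrow> nat list" where
  "encode_numbered G X \<equiv> encode [0..<card (pverts G)] G X"

definition vars :: "nat \<Rightarrow> ram_state \<Rightarrow> nat list" where
  "vars d s = map (\<lambda>i. reg s (4 + 2 * i)) [0..<d]"

definition vertex_tuple :: "nat \<Rightarrow> nat pair_pre_digraph \<Rightarrow> nat set \<Rightarrow> nat list \<Rightarrow> bool" where
  "vertex_tuple d G X e \<longleftrightarrow> numbered_instance G X \<and> length e = d \<and> set e \<subseteq> pverts G"

definition ready :: "nat \<Rightarrow> nat pair_pre_digraph \<Rightarrow> nat set \<Rightarrow> ram_state \<Rightarrow> bool" where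
  "ready d G X s \<longleftrightarrow> vertex_tuple d G X (vars d s) \<and>
     mem s = mem (input_state (encode_numbered G X)) \<and> reg s 0 = card (pverts G) \<and> reg s 1 = 1"

definition yields :: "nat \<Rightarrow> nat \<Rightarrow> nat list \<Rightarrow> ram_state \<Rightarrow> ram_state \<Rightarrow> bool" where
  "yields d k u s s' \<longleftrightarrow> mem s' = mem s \<and> (\<forall>j<4 + 2 * d. j \<notin> {2, 3} \<longrightarrow> reg s' j = reg s j) \<and>
     reg s' 2 = k \<and> out s' = out s @ u"

text \<open>With the program existentially quantified, closure properties take the place of programming.
  Value and output word are tracked together so that loops have to be treated only once.\<close>

type_synonym 'b query = "nat pair_pre_digraph \<Rightarrow> nat set \<Rightarrow> nat list \<Rightarrow> 'b"

definition poly_time :: "nat \<Rightarrow> nat query \<Rightarrow> nat list query \<Rightarrow> bool" where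
  "poly_time d f w \<longleftrightarrow> (\<exists>c p. \<forall>G X s. ready d G X s \<longrightarrow>
     runs c s (poly p (reg s 0)) (yields d (f G X (vars d s)) (w G X (vars d s)) s))"

abbreviation poly_computable :: "nat \<Rightarrow> nat query \<Rightarrow> bool" where
  "poly_computable d f \<equiv> poly_time d f (\<lambda>_ _ _. [])"

abbreviation poly_decidable :: "nat \<Rightarrow> bool query \<Rightarrow> bool" where
  "poly_decidable d P \<equiv> poly_computable d (\<lambda>G X e. of_bool (P G X e))"

lemma length_vars [simp]: "length (vars d s) = d"
  by (simp add: vars_def)

lemma nth_vars [simp]: "i < d \<Longrightarrow> vars d s ! i = reg s (4 + 2 * i)"
  by (simp add: vars_def)

lemma vars_Suc: "vars (Suc d) s = vars d s @ [reg s (4 + 2 * d)]"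
  by (simp add: vars_def)

lemma take_vars_Suc: "take d (vars (Suc d) s) = vars d s"
  by (simp add: vars_Suc)

lemma pverts_ready: "ready d G X s \<Longrightarrow> pverts G = {..<reg s 0}"
  by (auto simp: ready_def vertex_tuple_def numbered_instance_def)

lemma ready_Suc: "ready (Suc d) G X s \<longleftrightarrow> ready d G X s \<and> reg s (4 + 2 * d) < reg s 0"
  using pverts_ready[of d G X s] by (auto simp: ready_def vertex_tuple_def vars_Suc)

lemma yields_trans:
  "yields d k u s s' \<Longrightarrow> yields d l v s' s'' \<Longrightarrow> yields d l (u @ v) s s''"
  by (simp add: yields_def)

lemma yields_le: "yields d k u s s' \<Longrightarrow> d' \<le> d \<Longrightarrow> yields d' k u s s'"
  by (simp add: yields_def)

lemma vars_yields: "yields d k u s s' \<Longrightarrow> vars d s' = vars d s"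
  by (simp add: yields_def vars_def)

lemma reg_yields:
  assumes "yields d k u s s'"
  shows "reg s' 0 = reg s 0" "reg s' (Suc 0) = reg s (Suc 0)" "reg s' 2 = k"
  using assms by (simp_all add: yields_def)

lemma ready_yields: "yields d k u s s' \<Longrightarrow> ready d G X s' \<longleftrightarrow> ready d G X s"
  using reg_yields[of d k u s s'] vars_yields[of d k u s s'] by (simp add: ready_def yields_def)

lemma poly_timeI:
  assumes "\<And>G X s. ready d G X s \<Longrightarrow>
    runs c s (poly p (reg s 0)) (yields d (f G X (vars d s)) (w G X (vars d s)) s)"
  shows "poly_time d f w"
  using assms unfolding poly_time_def by blast

lemma poly_timeE:
  assumes "poly_time d f w"
  obtains c p where "\<And>G X s. ready d G X s \<Longrightarrow>
    runs c s (poly p (reg s 0)) (yields d (f G X (vars d s)) (w G X (vars d s)) s)"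
  using assms unfolding poly_time_def by blast

lemma poly_time_cong:
  assumes "poly_time d f w"
    and "\<And>G X e. vertex_tuple d G X e \<Longrightarrow> f G X e = f' G X e"
    and "\<And>G X e. vertex_tuple d G X e \<Longrightarrow> w G X e = w' G X e"
  shows "poly_time d f' w'"
proof -
  obtain c p where run: "\<And>G X s. ready d G X s \<Longrightarrow>
      runs c s (poly p (reg s 0)) (yields d (f G X (vars d s)) (w G X (vars d s)) s)"
    using assms(1) by (rule poly_timeE) blast
  show ?thesis
  proof (rule poly_timeI)
    fix G X s
    assume s: "ready d G X s"
    then have "vertex_tuple d G X (vars d s)"
      by (simp add: ready_def)
    with run[OF s] show
      "runs c s (poly p (reg s 0)) (yields d (f' G X (vars d s)) (w' G X (vars d s)) s)"
      by (simp add: assms(2,3))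
  qed
qed

lemma poly_computable_cong:
  assumes "poly_computable d f" and "\<And>G X e. vertex_tuple d G X e \<Longrightarrow> f G X e = f' G X e"
  shows "poly_computable d f'"
  using assms by (rule poly_time_cong) simp_all

lemma poly_decidable_cong:
  assumes "poly_decidable d P" and "\<And>G X e. vertex_tuple d G X e \<Longrightarrow> P G X e \<longleftrightarrow> P' G X e"
  shows "poly_decidable d P'"
  using assms by (intro poly_computable_cong[OF assms(1)]) simp

lemma poly_computable_const: "poly_computable d (\<lambda>_ _ _. k)"
  by (rule poly_timeI[of d "Const 2 k" "[:1:]"]) (auto intro!: runs_instr simp: yields_def)

lemma poly_computable_diff:
  assumes "i < d" "j < d"
  shows "poly_computable d (\<lambda>_ _ e. e ! i - e ! j)"
  by (rule poly_timeI[of d "Sub 2 (4 + 2 * i) (4 + 2 * j)" "[:1:]"])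
    (use assms in \<open>auto intro!: runs_instr simp: yields_def\<close>)

lemma poly_time_bind:
  assumes "poly_time d f w"
    and run: "\<And>G X s. ready d G X s \<Longrightarrow> runs c s (poly p (reg s 0))
      (yields d (g G X (vars d s) (reg s 2)) (u G X (vars d s) (reg s 2)) s)"
  shows "poly_time d (\<lambda>G X e. g G X e (f G X e)) (\<lambda>G X e. w G X e @ u G X e (f G X e))"
proof -
  obtain b q where run_first: "\<And>G X s. ready d G X s \<Longrightarrow>
      runs b s (poly q (reg s 0)) (yields d (f G X (vars d s)) (w G X (vars d s)) s)"
    using assms(1) by (rule poly_timeE) blast
  show ?thesis
  proof (rule poly_timeI[of d "Seq b c" "q + p"])
    fix G X s
    assume s: "ready d G X s"
    let ?k = "f G X (vars d s)" and ?w = "w G X (vars d s)"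
    let ?Q = "yields d (g G X (vars d s) ?k) (?w @ u G X (vars d s) ?k) s"
    have "runs c s' (poly p (reg s 0)) ?Q" if s': "yields d ?k ?w s s'" for s'
      using run[of G X s'] s yields_trans[OF s'] ready_yields[OF s'] vars_yields[OF s']
        reg_yields[OF s']
      by (auto intro: runs_mono)
    then show "runs (Seq b c) s (poly (q + p) (reg s 0)) ?Q"
      unfolding poly_add by (intro runs_Seq runs_mono[OF run_first[OF s] order.refl])
  qed
qed

lemma poly_time_seq:
  assumes "poly_time d f w" and "poly_time d g u"
  shows "poly_time d g (\<lambda>G X e. w G X e @ u G X e)"
  using assms(2) by (rule poly_timeE) (rule poly_time_bind[OF assms(1)])

lemma poly_time_write:
  assumes "poly_computable d f"
  shows "poly_time d f (\<lambda>G X e. [f G X e])"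
proof -
  have "poly_time d f (\<lambda>G X e. [] @ [f G X e])"
    by (rule poly_time_bind[OF assms, of "Write 2" "[:1:]" "\<lambda>_ _ _ k. k" "\<lambda>_ _ _ k. [k]"])
      (auto intro!: runs_instr simp: yields_def)
  then show ?thesis
    by simp
qed

lemma poly_computable_bind:
  assumes "poly_computable d f"
    and "\<And>G X s. ready d G X s \<Longrightarrow> runs c s t (yields d (g G X (vars d s) (reg s 2)) [] s)"
  shows "poly_computable d (\<lambda>G X e. g G X e (f G X e))"
  using poly_time_bind[OF assms(1), of c "[:t:]" g "\<lambda>_ _ _ _. []"] assms(2) by simp

lemma poly_computable_const_diff:
  assumes "poly_computable d f"
  shows "poly_computable d (\<lambda>G X e. k - f G X e)"
proof (rule poly_computable_bind[OF assms, of "Seq (Const 3 k) (Sub 2 3 2)" "1 + 1"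
      "\<lambda>_ _ _ l. k - l"])
  show "runs (Seq (Const 3 k) (Sub 2 3 2)) s (1 + 1) (yields d (k - reg s 2) [] s)" for s
    by (intro runs_Seq runs_instr) (auto simp: yields_def)
qed

lemma poly_computable_add_one:
  assumes "poly_computable d f"
  shows "poly_computable d (\<lambda>G X e. f G X e + 1)"
  by (rule poly_computable_bind[OF assms, of "Add 2 2 1" 1 "\<lambda>_ _ _ k. k + 1"])
    (auto intro!: runs_instr simp: yields_def ready_def)

lemma poly_computable_add_card:
  assumes "poly_computable d f"
  shows "poly_computable d (\<lambda>G X e. f G X e + card (pverts G))"
  by (rule poly_computable_bind[OF assms, of "Add 2 2 0" 1 "\<lambda>G _ _ k. k + card (pverts G)"])
    (auto intro!: runs_instr simp: yields_def ready_def)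

lemma poly_computable_add_var:
  assumes "poly_computable d f" and "i < d"
  shows "poly_computable d (\<lambda>G X e. f G X e + e ! i)"
  by (rule poly_computable_bind[OF assms(1), of "Add 2 2 (4 + 2 * i)" 1 "\<lambda>_ _ e k. k + e ! i"])
    (use assms(2) in \<open>auto intro!: runs_instr simp: yields_def\<close>)

lemma poly_computable_input:
  assumes "poly_computable d f"
  shows "poly_computable d (\<lambda>G X e. mem (input_state (encode_numbered G X)) (f G X e))"
  by (rule poly_computable_bind[OF assms, of "Load 2 2" 1
        "\<lambda>G X _. mem (input_state (encode_numbered G X))"])
    (auto intro!: runs_instr simp: yields_def ready_def)

lemma poly_time_if_nonzero:
  assumes "poly_computable d b" and "poly_time d f w" and "poly_time d g u"
  shows "poly_time d (\<lambda>G X e. if b G X e \<noteq> 0 then f G X e else g G X e)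
    (\<lambda>G X e. if b G X e \<noteq> 0 then w G X e else u G X e)"
proof -
  obtain c p where run_test: "\<And>G X s. ready d G X s \<Longrightarrow>
      runs c s (poly p (reg s 0)) (yields d (b G X (vars d s)) [] s)"
    using assms(1) by (rule poly_timeE) blast
  obtain c\<^sub>1 p\<^sub>1 where run_then: "\<And>G X s. ready d G X s \<Longrightarrow>
      runs c\<^sub>1 s (poly p\<^sub>1 (reg s 0)) (yields d (f G X (vars d s)) (w G X (vars d s)) s)"
    using assms(2) by (rule poly_timeE) blast
  obtain c\<^sub>2 p\<^sub>2 where run_else: "\<And>G X s. ready d G X s \<Longrightarrow>
      runs c\<^sub>2 s (poly p\<^sub>2 (reg s 0)) (yields d (g G X (vars d s)) (u G X (vars d s)) s)"
    using assms(3) by (rule poly_timeE) blast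
  show ?thesis
  proof (rule poly_timeI[of d "Seq c (If 2 c\<^sub>1 c\<^sub>2)" "p + (p\<^sub>1 + p\<^sub>2 + [:1:])"])
    fix G X s
    assume s: "ready d G X s"
    let ?b = "b G X (vars d s) \<noteq> 0"
    let ?Q = "yields d (if ?b then f G X (vars d s) else g G X (vars d s))
      (if ?b then w G X (vars d s) else u G X (vars d s)) s"
    have "runs (If 2 c\<^sub>1 c\<^sub>2) s' (poly p\<^sub>1 (reg s 0) + poly p\<^sub>2 (reg s 0) + 1) ?Q"
      if s': "yields d (b G X (vars d s)) [] s s'" for s'
    proof -
      note at_s' = ready_yields[OF s'] vars_yields[OF s'] reg_yields[OF s']
      have trans: "yields d k v s' s'' \<Longrightarrow> yields d k v s s''" for k v s''
        using yields_trans[OF s'] by simp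
      show ?thesis
        using run_then[of G X s'] run_else[of G X s'] s
        by (intro runs_If) (auto simp: at_s' intro: trans runs_mono)
    qed
    then have "runs (Seq c (If 2 c\<^sub>1 c\<^sub>2)) s
        (poly p (reg s 0) + (poly p\<^sub>1 (reg s 0) + poly p\<^sub>2 (reg s 0) + 1)) ?Q"
      by (intro runs_Seq runs_mono[OF run_test[OF s] order.refl])
    then show "runs (Seq c (If 2 c\<^sub>1 c\<^sub>2)) s (poly (p + (p\<^sub>1 + p\<^sub>2 + [:1:])) (reg s 0)) ?Q"
      by (rule runs_mono) simp_all
  qed
qed

definition for_each_step :: "nat \<Rightarrow> com \<Rightarrow> com" where
  "for_each_step d c = Seq c (Seq (Add (5 + 2 * d) (5 + 2 * d) 2)
     (Seq (Add (4 + 2 * d) (4 + 2 * d) 1) (Sub 3 0 (4 + 2 * d))))"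

definition for_each :: "nat \<Rightarrow> com \<Rightarrow> com" where
  "for_each d c = Seq (Const (4 + 2 * d) 0) (Seq (Const (5 + 2 * d) 0) (Seq (Sub 3 0 (4 + 2 * d))
     (Seq (While 3 (for_each_step d c)) (Add 2 (5 + 2 * d) 3))))"

definition for_each_invariant ::
  "nat \<Rightarrow> (nat \<Rightarrow> nat) \<Rightarrow> (nat \<Rightarrow> nat list) \<Rightarrow> ram_state \<Rightarrow> nat \<Rightarrow> ram_state \<Rightarrow> bool" where
  "for_each_invariant d f w s v s' \<longleftrightarrow> reg s' (4 + 2 * d) = v \<and> reg s' (5 + 2 * d) = (\<Sum>u<v. f u) \<and>
     reg s' 3 = reg s 0 - v \<and> yields d (reg s' 2) (concat (map w [0..<v])) s s'"

lemma runs_for_each_step: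
  assumes s: "ready d G X s" and s': "for_each_invariant d f w s v s'" and v: "v < reg s 0"
    and body: "\<And>s'. \<lbrakk>ready (Suc d) G X s'; vars d s' = vars d s; reg s' 0 = reg s 0\<rbrakk> \<Longrightarrow>
      runs c s' T (yields (Suc d) (f (reg s' (4 + 2 * d))) (w (reg s' (4 + 2 * d))) s')"
  shows "runs (for_each_step d c) s' (T + (1 + (1 + 1))) (for_each_invariant d f w s (Suc v))"
proof -
  have before: "yields d (reg s' 2) (concat (map w [0..<v])) s s'"
    and loop_var: "reg s' (4 + 2 * d) = v"
    and acc: "reg s' (5 + 2 * d) = (\<Sum>u<v. f u)"
    using s' by (simp_all add: for_each_invariant_def)
  have "ready (Suc d) G X s'"
    using s v loop_var reg_yields(1)[OF before] by (simp add: ready_Suc ready_yields[OF before])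
  from body[OF this] have "runs c s' T (yields (Suc d) (f v) (w v) s')"
    by (simp add: loop_var vars_yields[OF before] reg_yields(1)[OF before])
  then show ?thesis
    unfolding for_each_step_def
  proof (intro runs_Seq, rule runs_mono[OF _ order.refl])
    fix s''
    assume after: "yields (Suc d) (f v) (w v) s' s''"
    have "reg s'' (4 + 2 * d) = v" "reg s'' (5 + 2 * d) = (\<Sum>u<v. f u)" "reg s'' 2 = f v"
      "reg s'' (Suc 0) = 1" "reg s'' 0 = reg s 0"
      using after before s acc loop_var by (auto simp: yields_def ready_def)
    moreover have "yields d (f v) (concat (map w [0..<Suc v])) s s''"
      using yields_trans[OF before yields_le[OF after]] by simp
    ultimately show "runs (Seq (Add (5 + 2 * d) (5 + 2 * d) 2)
        (Seq (Add (4 + 2 * d) (4 + 2 * d) 1) (Sub 3 0 (4 + 2 * d)))) s'' (1 + (1 + 1))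
        (for_each_invariant d f w s (Suc v))"
      by (intro runs_Seq runs_instr) (auto simp: for_each_invariant_def yields_def)
  qed
qed

lemma runs_for_each:
  assumes s: "ready d G X s"
    and body: "\<And>s'. \<lbrakk>ready (Suc d) G X s'; vars d s' = vars d s; reg s' 0 = reg s 0\<rbrakk> \<Longrightarrow>
      runs c s' T (yields (Suc d) (f (reg s' (4 + 2 * d))) (w (reg s' (4 + 2 * d))) s')"
  shows "runs (for_each d c) s (reg s 0 * (T + 4) + 5)
    (yields d (\<Sum>v<reg s 0. f v) (concat (map w [0..<reg s 0])) s)"
proof -
  let ?n = "reg s 0"
  define I where "I k s' \<longleftrightarrow> k \<le> ?n \<and> for_each_invariant d f w s (?n - k) s'" for k s'
  have step: "runs (for_each_step d c) s' (T + (1 + (1 + 1))) (\<lambda>s'. \<exists>j<k. I j s')"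
    if "I k s'" "reg s' 3 \<noteq> 0" for k s'
  proof -
    have k: "0 < k" "k \<le> ?n"
      using that by (auto simp: I_def for_each_invariant_def)
    have "for_each_invariant d f w s (?n - k) s'" "?n - k < ?n"
      using that(1) k by (simp_all add: I_def)
    then have "runs (for_each_step d c) s' (T + (1 + (1 + 1)))
        (for_each_invariant d f w s (Suc (?n - k)))"
      using s body by (intro runs_for_each_step)
    moreover have "Suc (?n - k) = ?n - (k - 1)"
      using k by simp
    ultimately show ?thesis
      using k by (auto simp: I_def elim!: runs_mono intro!: exI[of _ "k - 1"])
  qed
  have "runs (for_each d c) s (1 + (1 + (1 + ((?n * (T + (1 + (1 + 1)) + 1) + 1) + 1))))
      (yields d (\<Sum>v<?n. f v) (concat (map w [0..<?n])) s)"
    unfolding for_each_def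
    by (intro runs_Seq runs_instr[OF zero_less_one],
        rule runs_mono[OF runs_While[of I ?n, OF _ step] order.refl])
      (auto intro!: runs_instr simp: I_def for_each_invariant_def yields_def)
  then show ?thesis
    by (rule runs_mono) (simp_all add: algebra_simps)
qed

lemma poly_time_for:
  assumes "poly_time (Suc d) (\<lambda>G X e. f G X (take d e) (e ! d)) (\<lambda>G X e. w G X (take d e) (e ! d))"
  shows "poly_time d (\<lambda>G X e. \<Sum>v\<in>pverts G. f G X e v)
    (\<lambda>G X e. concat (map (w G X e) [0..<card (pverts G)]))"
proof -
  obtain c p where run: "\<And>G X s. ready (Suc d) G X s \<Longrightarrow> runs c s (poly p (reg s 0))
      (yields (Suc d) (f G X (take d (vars (Suc d) s)) (vars (Suc d) s ! d))
        (w G X (take d (vars (Suc d) s)) (vars (Suc d) s ! d)) s)"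
    using assms by (rule poly_timeE) blast
  show ?thesis
  proof (rule poly_timeI[of d "for_each d c" "[:0, 1:] * (p + [:4:]) + [:5:]"])
    fix G X s
    assume s: "ready d G X s"
    let ?n = "reg s 0"
    have "runs c s' (poly p ?n) (yields (Suc d) (f G X (vars d s) (reg s' (4 + 2 * d)))
        (w G X (vars d s) (reg s' (4 + 2 * d))) s')"
      if "ready (Suc d) G X s'" "vars d s' = vars d s" "reg s' 0 = ?n" for s'
      using run[OF that(1)] that(2,3) by (simp add: take_vars_Suc)
    then have "runs (for_each d c) s (?n * (poly p ?n + 4) + 5)
        (yields d (\<Sum>v<?n. f G X (vars d s) v) (concat (map (w G X (vars d s)) [0..<?n])) s)"
      by (intro runs_for_each[OF s])
    moreover have "pverts G = {..<?n}"
      using s by (rule pverts_ready)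
    ultimately show "runs (for_each d c) s (poly ([:0, 1:] * (p + [:4:]) + [:5:]) ?n)
        (yields d (\<Sum>v\<in>pverts G. f G X (vars d s) v)
          (concat (map (w G X (vars d s)) [0..<card (pverts G)])) s)"
      by (simp add: algebra_simps)
  qed
qed

lemma poly_time_if:
  assumes "poly_decidable d P" and "poly_time d f w" and "poly_time d g u"
  shows "poly_time d (\<lambda>G X e. if P G X e then f G X e else g G X e)
    (\<lambda>G X e. if P G X e then w G X e else u G X e)"
  using poly_time_if_nonzero[OF assms] by simp

lemma poly_computable_if:
  assumes "poly_decidable d P" and "poly_computable d f" and "poly_computable d g"
  shows "poly_computable d (\<lambda>G X e. if P G X e then f G X e else g G X e)"
  using poly_time_if[OF assms] by simp

lemma poly_decidable_if_nonzero:
  assumes "poly_computable d f"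
  shows "poly_decidable d (\<lambda>G X e. f G X e \<noteq> 0)"
  using poly_time_if_nonzero[OF assms poly_computable_const[of d 1] poly_computable_const[of d 0]]
  by (simp add: of_bool_def)

lemma poly_decidable_not:
  assumes "poly_decidable d P"
  shows "poly_decidable d (\<lambda>G X e. \<not> P G X e)"
  using poly_computable_if[OF assms poly_computable_const[of d 0] poly_computable_const[of d 1]]
  by (rule poly_computable_cong) simp

lemma poly_decidable_conj:
  assumes "poly_decidable d P" and "poly_decidable d Q"
  shows "poly_decidable d (\<lambda>G X e. P G X e \<and> Q G X e)"
  using poly_computable_if[OF assms poly_computable_const[of d 0]]
  by (rule poly_computable_cong) simp

lemma poly_decidable_disj:
  assumes "poly_decidable d P" and "poly_decidable d Q"
  shows "poly_decidable d (\<lambda>G X e. P G X e \<or> Q G X e)"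
  using poly_computable_if[OF assms(1) poly_computable_const[of d 1] assms(2)]
  by (rule poly_computable_cong) simp

lemma poly_decidable_less:
  assumes "i < d" "j < d"
  shows "poly_decidable d (\<lambda>_ _ e. e ! i < e ! j)"
  using poly_decidable_if_nonzero[OF poly_computable_diff[OF assms(2,1)]] by (simp add: not_le)

lemma poly_computable_sum:
  assumes "poly_computable (Suc d) (\<lambda>G X e. f G X (take d e) (e ! d))"
  shows "poly_computable d (\<lambda>G X e. \<Sum>v\<in>pverts G. f G X e v)"
  using poly_time_for[OF assms] by (simp add: map_replicate_const)

lemma finite_pverts_numbered: "numbered_instance G X \<Longrightarrow> finite (pverts G)"
  by (auto simp: numbered_instance_def)

lemma finite_pverts_vertex_tuple: "vertex_tuple d G X e \<Longrightarrow> finite (pverts G)"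
  unfolding vertex_tuple_def using finite_pverts_numbered by blast

lemma poly_computable_card:
  assumes "poly_decidable (Suc d) (\<lambda>G X e. P G X (take d e) (e ! d))"
  shows "poly_computable d (\<lambda>G X e. card {v \<in> pverts G. P G X e v})"
  using poly_computable_sum[OF assms]
  by (rule poly_computable_cong)
    (simp add: finite_pverts_vertex_tuple sum_of_bool_eq Int_def)

lemma poly_decidable_bex:
  assumes "poly_decidable (Suc d) (\<lambda>G X e. P G X (take d e) (e ! d))"
  shows "poly_decidable d (\<lambda>G X e. \<exists>v\<in>pverts G. P G X e v)"
  using poly_decidable_if_nonzero[OF poly_computable_sum[OF assms]]
  by (rule poly_decidable_cong) (auto simp: finite_pverts_vertex_tuple)

lemma poly_decidable_card_less:
  assumes "poly_decidable (Suc d) (\<lambda>G X e. P G X (take d e) (e ! d))"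
  shows "poly_decidable d (\<lambda>G X e. card {v \<in> pverts G. P G X e v} < k)"
  using poly_decidable_if_nonzero[OF poly_computable_const_diff[OF poly_computable_card[OF assms]]]
  by (simp add: not_le)

lemma concat_nth_uniform:
  "\<lbrakk>\<forall>ys\<in>set xss. length ys = n; i < length xss; j < n\<rbrakk> \<Longrightarrow> concat xss ! (i * n + j) = xss ! i ! j"
proof (induction xss arbitrary: i)
  case (Cons ys xss)
  then show ?case
    by (cases i) (auto simp: nth_append)
qed simp

lemma length_concat_uniform:
  "\<forall>ys\<in>set xss. length ys = n \<Longrightarrow> length (concat xss) = length xss * n"
  by (induction xss) auto

lemma mem_encode:
  defines "m \<equiv> \<lambda>vs G X. mem (input_state (encode vs G X))"
  shows "m vs G X 0 = length vs"
    and "i < length vs \<Longrightarrow> m vs G X (1 + i) = of_bool (vs ! i \<in> X)"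
    and "\<lbrakk>i < length vs; j < length vs\<rbrakk> \<Longrightarrow>
      m vs G X (1 + length vs + i * length vs + j) = of_bool ((vs ! i, vs ! j) \<in> parcs G)"
proof -
  let ?n = "length vs"
  show "m vs G X 0 = ?n"
    by (simp add: m_def input_state_def encode_def)
  show "m vs G X (1 + i) = of_bool (vs ! i \<in> X)" if "i < ?n"
    using that by (simp add: m_def input_state_def encode_def nth_append)
  show "m vs G X (1 + ?n + i * ?n + j) = of_bool ((vs ! i, vs ! j) \<in> parcs G)"
    if ij: "i < ?n" "j < ?n"
  proof -
    let ?M = "map (\<lambda>u. map (\<lambda>v. of_bool ((u, v) \<in> parcs G)) vs) vs :: nat list list"
    have "(i + 1) * ?n \<le> ?n * ?n"
      using ij by (intro mult_right_mono) auto
    then have "i * ?n + j < length (concat ?M)"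
      using ij length_concat_uniform[of ?M ?n] by simp
    moreover have "concat ?M ! (i * ?n + j) = of_bool ((vs ! i, vs ! j) \<in> parcs G)"
      using concat_nth_uniform[of ?M ?n i j] ij by simp
    ultimately show ?thesis
      by (simp add: m_def input_state_def encode_def nth_append)
  qed
qed

lemma nth_vertex_tuple:
  assumes "vertex_tuple d G X e" and "i < d"
  shows "e ! i \<in> pverts G" and "e ! i < card (pverts G)"
proof -
  show "e ! i \<in> pverts G"
    using assms nth_mem[of i e] by (auto simp: vertex_tuple_def)
  then show "e ! i < card (pverts G)"
    using assms(1) by (auto simp: vertex_tuple_def numbered_instance_def)
qed

lemma poly_decidable_member:
  assumes "i < d"
  shows "poly_decidable d (\<lambda>_ X e. e ! i \<in> X)"
  using poly_computable_input[OF poly_computable_add_one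
      [OF poly_computable_add_var[OF poly_computable_const[of d 0] assms]]]
proof (rule poly_computable_cong)
  fix G :: "nat pair_pre_digraph" and X e
  assume "vertex_tuple d G X e"
  then show "mem (input_state (encode_numbered G X)) (0 + e ! i + 1) = of_bool (e ! i \<in> X)"
    using mem_encode(2)[of "e ! i" "[0..<card (pverts G)]" G X] nth_vertex_tuple(2)[of d G X e i]
      assms by simp
qed

lemma poly_computable_mult_card:
  assumes "i < d"
  shows "poly_computable d (\<lambda>G X e. e ! i * card (pverts G))"
proof -
  have "poly_computable d
      (\<lambda>G X e. \<Sum>v\<in>pverts G. if v < e ! i then 0 + card (pverts G) else 0)"
    using poly_decidable_less[of d "Suc d" i] assms
    by (intro poly_computable_sum poly_computable_if poly_computable_add_card poly_computable_const)
      simp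
  then show ?thesis
  proof (rule poly_computable_cong)
    fix G :: "nat pair_pre_digraph" and X e
    assume e: "vertex_tuple d G X e"
    then obtain n where n: "pverts G = {..<n}"
      unfolding vertex_tuple_def numbered_instance_def by blast
    then have "e ! i < n"
      using nth_vertex_tuple(2)[OF e assms] by simp
    then have "{..<n} \<inter> {v. v < e ! i} = {..<e ! i}"
      by (auto simp: set_eq_iff)
    with n show "(\<Sum>v\<in>pverts G. if v < e ! i then 0 + card (pverts G) else 0) =
        e ! i * card (pverts G)"
      by (simp add: sum.If_cases)
  qed
qed

lemma poly_decidable_adjacent:
  assumes "i < d" "j < d"
  shows "poly_decidable d (\<lambda>G _ e. (e ! i, e ! j) \<in> parcs G)"
  using poly_computable_input[OF poly_computable_add_one[OF poly_computable_add_card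
      [OF poly_computable_add_var[OF poly_computable_mult_card[OF assms(1)] assms(2)]]]]
proof (rule poly_computable_cong)
  fix G :: "nat pair_pre_digraph" and X e
  assume "vertex_tuple d G X e"
  then show "mem (input_state (encode_numbered G X))
      (e ! i * card (pverts G) + e ! j + card (pverts G) + 1) = of_bool ((e ! i, e ! j) \<in> parcs G)"
    using mem_encode(3)[of "e ! i" "[0..<card (pverts G)]" "e ! j" G X]
      nth_vertex_tuple(2)[of d G X e] assms by (simp add: algebra_simps)
qed

section \<open>Polynomial-time definable sets of vertices\<close>

text \<open>The membership test has to work at every depth \<open>d' \<ge> d\<close>, since it is also used below further
  quantifiers.\<close>

definition definable :: "nat \<Rightarrow> nat set query \<Rightarrow> bool" where
  "definable d N \<longleftrightarrow>
     (\<forall>G X e. vertex_tuple d G X e \<longrightarrow> N G X e \<subseteq> pverts G) \<and>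
     (\<forall>d' i. d \<le> d' \<longrightarrow> i < d' \<longrightarrow> poly_decidable d' (\<lambda>G X e. e ! i \<in> N G X (take d e)))"

lemma definableI:
  assumes "\<And>G X e. vertex_tuple d G X e \<Longrightarrow> N G X e \<subseteq> pverts G"
    and "\<And>d' i. \<lbrakk>d \<le> d'; i < d'\<rbrakk> \<Longrightarrow> poly_decidable d' (\<lambda>G X e. e ! i \<in> N G X (take d e))"
  shows "definable d N"
  using assms unfolding definable_def by blast

lemma definable_subset: "definable d N \<Longrightarrow> vertex_tuple d G X e \<Longrightarrow> N G X e \<subseteq> pverts G"
  unfolding definable_def by blast

lemma vertex_tuple_take: "vertex_tuple d' G X e \<Longrightarrow> d \<le> d' \<Longrightarrow> vertex_tuple d G X (take d e)"
  using set_take_subset[of d e] by (auto simp: vertex_tuple_def)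

lemma poly_decidable_definable:
  "\<lbrakk>definable d N; d \<le> d'; i < d'\<rbrakk> \<Longrightarrow> poly_decidable d' (\<lambda>G X e. e ! i \<in> N G X (take d e))"
  unfolding definable_def by blast

lemma definable_take:
  assumes "definable d N" and "d \<le> d'"
  shows "definable d' (\<lambda>G X e. N G X (take d e))"
  using definable_subset[OF assms(1) vertex_tuple_take] poly_decidable_definable[OF assms(1)]
    assms(2)
  by (intro definableI) (simp_all add: min_absorb1)

lemma definable_modulator: "definable d (\<lambda>_ X _. X)"
  by (rule definableI)
    (auto simp: vertex_tuple_def numbered_instance_def intro: poly_decidable_member)

lemma definable_pverts: "definable d (\<lambda>G _ _. pverts G)"
proof (rule definableI)
  show "poly_decidable d' (\<lambda>G X e. e ! i \<in> pverts G)" if "i < d'" for d' i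
    by (rule poly_computable_cong[OF poly_computable_const[of d' 1]])
      (simp add: nth_vertex_tuple(1)[OF _ that])
qed simp

lemma definable_neighbours:
  assumes "j < d"
  shows "definable d (\<lambda>G X e. parcs G `` {e ! j})"
  by (rule definableI)
    (use assms in \<open>auto simp: vertex_tuple_def numbered_instance_def
      intro: poly_decidable_adjacent\<close>)

lemma definable_Un: "definable d M \<Longrightarrow> definable d N \<Longrightarrow> definable d (\<lambda>G X e. M G X e \<union> N G X e)"
  unfolding definable_def using poly_decidable_disj by simp

lemma definable_Int: "definable d M \<Longrightarrow> definable d N \<Longrightarrow> definable d (\<lambda>G X e. M G X e \<inter> N G X e)"
  unfolding definable_def using poly_decidable_conj by (simp add: le_infI1)

lemma definable_Diff: "definable d M \<Longrightarrow> definable d N \<Longrightarrow> definable d (\<lambda>G X e. M G X e - N G X e)"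
  unfolding definable_def using poly_decidable_conj[OF _ poly_decidable_not]
  by (simp add: Diff_subset_conv le_supI2)

lemma poly_decidable_bex_definable:
  assumes "definable d N" and "d \<le> d'"
    and "poly_decidable (Suc d') (\<lambda>G X e. P G X (take d' e) (e ! d'))"
  shows "poly_decidable d' (\<lambda>G X e. \<exists>v\<in>N G X (take d e). P G X e v)"
proof -
  have "poly_decidable (Suc d')
      (\<lambda>G X e. e ! d' \<in> N G X (take d (take d' e)) \<and> P G X (take d' e) (e ! d'))"
    using poly_decidable_definable[OF assms(1), of "Suc d'" d'] assms(2)
    by (intro poly_decidable_conj assms(3)) (simp add: min_absorb1)
  then have "poly_decidable d' (\<lambda>G X e. \<exists>v\<in>pverts G. v \<in> N G X (take d e) \<and> P G X e v)"
    by (rule poly_decidable_bex)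
  then show ?thesis
  proof (rule poly_decidable_cong)
    fix G :: "nat pair_pre_digraph" and X e
    assume "vertex_tuple d' G X e"
    then have "N G X (take d e) \<subseteq> pverts G"
      using definable_subset[OF assms(1) vertex_tuple_take] assms(2) by blast
    then show "(\<exists>v\<in>pverts G. v \<in> N G X (take d e) \<and> P G X e v) \<longleftrightarrow>
        (\<exists>v\<in>N G X (take d e). P G X e v)"
      by blast
  qed
qed

lemma definable_cong:
  assumes "definable d N" and "\<And>G X e. vertex_tuple d G X e \<Longrightarrow> N G X e = N' G X e"
  shows "definable d N'"
proof (rule definableI)
  show "N' G X e \<subseteq> pverts G" if "vertex_tuple d G X e" for G X e
    using definable_subset[OF assms(1) that] assms(2)[OF that] by simp
  show "poly_decidable d' (\<lambda>G X e. e ! i \<in> N' G X (take d e))" if "d \<le> d'" "i < d'" for d' i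
    using poly_decidable_definable[OF assms(1) that]
    by (rule poly_decidable_cong) (simp add: assms(2) vertex_tuple_take[OF _ that(1)])
qed

lemma definable_smallest:
  assumes "definable d N"
  shows "definable d (\<lambda>G X e. smallest k (N G X e))"
proof (rule definableI)
  show "smallest k (N G X e) \<subseteq> pverts G" if "vertex_tuple d G X e" for G X e
    using definable_subset[OF assms that] smallest_subset by blast
  fix d' i
  assume d': "d \<le> d'" "i < d'"
  have "poly_decidable (Suc d')
      (\<lambda>G X e. e ! d' \<in> N G X (take d (take d' e)) \<and> e ! d' < take d' e ! i)"
    using poly_decidable_definable[OF assms, of "Suc d'" d']
      poly_decidable_less[of d' "Suc d'" i] d'
    by (intro poly_decidable_conj) (simp_all add: min_absorb1)
  from poly_decidable_card_less[OF this]
  have "poly_decidable d' (\<lambda>G X e. e ! i \<in> N G X (take d e) \<and>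
      card {v \<in> pverts G. v \<in> N G X (take d e) \<and> v < e ! i} < k)"
    by (intro poly_decidable_conj poly_decidable_definable[OF assms] d')
  then show "poly_decidable d' (\<lambda>G X e. e ! i \<in> smallest k (N G X (take d e)))"
  proof (rule poly_decidable_cong)
    fix G :: "nat pair_pre_digraph" and X e
    assume "vertex_tuple d' G X e"
    then have "N G X (take d e) \<subseteq> pverts G"
      using definable_subset[OF assms vertex_tuple_take] d'(1) by blast
    then have "{v \<in> pverts G. v \<in> N G X (take d e) \<and> v < e ! i} = {v \<in> N G X (take d e). v < e ! i}"
      by blast
    then show "e ! i \<in> N G X (take d e) \<and>
        card {v \<in> pverts G. v \<in> N G X (take d e) \<and> v < e ! i} < k \<longleftrightarrow>
        e ! i \<in> smallest k (N G X (take d e))"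
      by (simp add: smallest_def)
  qed
qed

lemma definable_class_leaders:
  assumes "definable d N"
  shows "definable d (\<lambda>G X e. class_leaders (parcs G) (N G X e))"
proof (rule definableI)
  show "class_leaders (parcs G) (N G X e) \<subseteq> pverts G" if "vertex_tuple d G X e" for G X e
    using definable_subset[OF assms that] by (auto simp: class_leaders_def)
  fix d' i
  assume d': "d \<le> d'" "i < d'"
  have "poly_decidable (Suc d')
      (\<lambda>G X e. e ! d' < take d' e ! i \<and> (e ! d', take d' e ! i) \<notin> parcs G)"
    using poly_decidable_less[of d' "Suc d'" i] poly_decidable_adjacent[of d' "Suc d'" i] d'
    by (intro poly_decidable_conj poly_decidable_not) simp_all
  from poly_decidable_not[OF poly_decidable_bex_definable[OF assms d'(1) this]]
  have "poly_decidable d' (\<lambda>G X e. e ! i \<in> N G X (take d e) \<and>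
      \<not> (\<exists>w\<in>N G X (take d e). w < e ! i \<and> (w, e ! i) \<notin> parcs G))"
    by (intro poly_decidable_conj poly_decidable_definable[OF assms] d')
  then show "poly_decidable d' (\<lambda>G X e. e ! i \<in> class_leaders (parcs G) (N G X (take d e)))"
    by (rule poly_decidable_cong) (auto simp: class_leaders_def)
qed

lemma definable_independent_neighbourhood:
  "definable d (\<lambda>G _ _. {v \<in> pverts G. independent (parcs G) (parcs G `` {v})})"
proof (rule definableI)
  fix d' i :: nat
  assume "i < d'"
  then have "poly_decidable (Suc (Suc d')) (\<lambda>G X e. (take (Suc d') e ! i, e ! Suc d') \<in> parcs G \<and>
      (take (Suc d') e ! d', e ! Suc d') \<in> parcs G)"
    using poly_decidable_adjacent[of i "Suc (Suc d')" "Suc d'"]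
      poly_decidable_adjacent[of d' "Suc (Suc d')" "Suc d'"]
    by (intro poly_decidable_conj) simp_all
  from poly_decidable_bex[OF this]
  have "poly_decidable (Suc d') (\<lambda>G X e. (e ! i, e ! d') \<in> parcs G \<and>
      (\<exists>w\<in>pverts G. (e ! i, w) \<in> parcs G \<and> (e ! d', w) \<in> parcs G))"
    using \<open>i < d'\<close> by (intro poly_decidable_conj poly_decidable_adjacent) simp_all
  then have "poly_decidable (Suc d') (\<lambda>G X e. (take d' e ! i, e ! d') \<in> parcs G \<and>
      (\<exists>w\<in>pverts G. (take d' e ! i, w) \<in> parcs G \<and> (e ! d', w) \<in> parcs G))"
    using \<open>i < d'\<close> by simp
  from poly_decidable_not[OF poly_decidable_bex[OF this]]
  have "poly_decidable d' (\<lambda>G X e. \<not> (\<exists>u\<in>pverts G. (e ! i, u) \<in> parcs G \<and>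
      (\<exists>w\<in>pverts G. (e ! i, w) \<in> parcs G \<and> (u, w) \<in> parcs G)))" .
  then show "poly_decidable d'
      (\<lambda>G X e. e ! i \<in> {v \<in> pverts G. independent (parcs G) (parcs G `` {v})})"
  proof (rule poly_decidable_cong)
    fix G :: "nat pair_pre_digraph" and X e
    assume e: "vertex_tuple d' G X e"
    then have "parcs G \<subseteq> pverts G \<times> pverts G" "e ! i \<in> pverts G"
      using nth_vertex_tuple(1)[OF e \<open>i < d'\<close>]
      by (simp_all add: vertex_tuple_def numbered_instance_def)
    then show "\<not> (\<exists>u\<in>pverts G. (e ! i, u) \<in> parcs G \<and>
        (\<exists>w\<in>pverts G. (e ! i, w) \<in> parcs G \<and> (u, w) \<in> parcs G)) \<longleftrightarrow>
        e ! i \<in> {v \<in> pverts G. independent (parcs G) (parcs G `` {v})}"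
      unfolding anticomplete_def by blast
  qed
qed blast

lemma definable_UN:
  assumes M: "definable d M"
    and N: "\<And>d' j. \<lbrakk>d \<le> d'; j < d'\<rbrakk> \<Longrightarrow> definable d' (\<lambda>G X e. N G X (take d e) (e ! j))"
  shows "definable d (\<lambda>G X e. \<Union>v\<in>M G X e. N G X e v)"
proof (rule definableI)
  fix G :: "nat pair_pre_digraph" and X e
  assume e: "vertex_tuple d G X e"
  have "N G X e v \<subseteq> pverts G" if "v \<in> M G X e" for v
    using definable_subset[OF N[of "Suc d" d], of G X "e @ [v]"] definable_subset[OF M e] e that
    by (auto simp: vertex_tuple_def nth_append)
  then show "(\<Union>v\<in>M G X e. N G X e v) \<subseteq> pverts G"
    by blast
next
  fix d' i
  assume d': "d \<le> d'" "i < d'"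
  have "poly_decidable (Suc d') (\<lambda>G X e. take d' e ! i \<in> N G X (take d (take d' e)) (e ! d'))"
    using poly_decidable_definable[OF N[of "Suc d'" d'], of "Suc d'" i] d'
    by (simp add: min_absorb1)
  then have "poly_decidable d' (\<lambda>G X e. \<exists>v\<in>M G X (take d e). e ! i \<in> N G X (take d e) v)"
    by (rule poly_decidable_bex_definable[OF M d'(1)])
  then show "poly_decidable d' (\<lambda>G X e. e ! i \<in> (\<Union>v\<in>M G X (take d e). N G X (take d e) v))"
    by simp
qed

lemma definable_cutset_kernel:
  "definable 0 (\<lambda>G X _. cutset_kernel (pverts G) (parcs G) X)"
proof -
  define leaders where "leaders G X x y z = smallest 3 (class_leaders (parcs G)
      ((pverts G - X) \<inter> (parcs G `` {x} \<inter> (parcs G `` {y} \<inter> parcs G `` {z}))))"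
    for G :: "nat pair_pre_digraph" and X x y z
  have leaders_at: "definable d (\<lambda>G X e. leaders G X (e ! i) (e ! j) (e ! k))"
    if "i < d" "j < d" "k < d" for d i j k
    unfolding leaders_def using that
    by (intro definable_smallest definable_class_leaders definable_Int definable_Diff definable_pverts
        definable_modulator definable_neighbours)
  have leaders_UN: "definable d (\<lambda>G X e. \<Union>z\<in>X. leaders G X (e ! i) (e ! j) z)"
    if "i < d" "j < d" for d i j
    by (rule definable_UN[OF definable_modulator]) (use that leaders_at in simp)
  have leaders_UN_UN: "definable d (\<lambda>G X e. \<Union>y\<in>X. \<Union>z\<in>X. leaders G X (e ! i) y z)"
    if "i < d" for d i
    by (rule definable_UN[OF definable_modulator]) (use that leaders_UN in simp)
  have "definable 0 (\<lambda>G X e. \<Union>x\<in>X. \<Union>y\<in>X. \<Union>z\<in>X. leaders G X x y z)"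
    by (rule definable_UN[OF definable_modulator]) (use leaders_UN_UN in simp)
  then have "definable 0 (\<lambda>G X e. X \<union> smallest 3 (pverts G) \<union>
      smallest 3 {v \<in> pverts G. independent (parcs G) (parcs G `` {v})} \<union>
      smallest 3 (class_leaders (parcs G) (pverts G - X)) \<union> (\<Union>x\<in>X. \<Union>y\<in>X. \<Union>z\<in>X. leaders G X x y z))"
    by (intro definable_Un definable_smallest definable_class_leaders definable_Diff definable_pverts
        definable_modulator definable_independent_neighbourhood)
  then show ?thesis
  proof (rule definable_cong)
    fix G :: "nat pair_pre_digraph" and X and e :: "nat list"
    assume "vertex_tuple 0 G X e"
    then have "finite X"
      using finite_pverts_numbered finite_subset
      by (auto simp: vertex_tuple_def numbered_instance_def)
    from cutset_kernel_eq[OF this]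
    show "X \<union> smallest 3 (pverts G) \<union>
      smallest 3 {v \<in> pverts G. independent (parcs G) (parcs G `` {v})} \<union>
      smallest 3 (class_leaders (parcs G) (pverts G - X)) \<union> (\<Union>x\<in>X. \<Union>y\<in>X. \<Union>z\<in>X. leaders G X x y z) =
      cutset_kernel (pverts G) (parcs G) X"
      by (simp add: leaders_def)
  qed
qed

definition poly_writable :: "nat \<Rightarrow> nat list query \<Rightarrow> bool" where
  "poly_writable d w \<longleftrightarrow> (\<exists>f. poly_time d f w)"

lemma poly_writable_cong:
  assumes "poly_writable d w"
    and "\<And>G X e. vertex_tuple d G X e \<Longrightarrow> w G X e = w' G X e"
  shows "poly_writable d w'"
  using assms unfolding poly_writable_def by (blast intro: poly_time_cong)

lemma poly_writable_value:
  assumes "poly_computable d f"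
  shows "poly_writable d (\<lambda>G X e. [f G X e])"
  unfolding poly_writable_def using poly_time_write[OF assms] by blast

lemma poly_writable_append:
  assumes "poly_writable d w" and "poly_writable d u"
  shows "poly_writable d (\<lambda>G X e. w G X e @ u G X e)"
  using assms unfolding poly_writable_def by (blast intro: poly_time_seq)

lemma concat_map_if_Nil:
  "concat (map (\<lambda>x. if P x then f x else []) xs) = concat (map f (filter P xs))"
  by (induction xs) simp_all

definition elements :: "nat set query \<Rightarrow> nat list query" where
  "elements N G X e = filter (\<lambda>v. v \<in> N G X e) [0..<card (pverts G)]"

lemma poly_writable_concat_elements:
  assumes N: "definable d N"
    and w: "poly_writable (Suc d) (\<lambda>G X e. w G X (take d e) (e ! d))"
  shows "poly_writable d (\<lambda>G X e. concat (map (w G X e) (elements N G X e)))"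
proof -
  obtain f where f: "poly_time (Suc d) f (\<lambda>G X e. w G X (take d e) (e ! d))"
    using w unfolding poly_writable_def by blast
  have "poly_time (Suc d) (\<lambda>G X e. f G X (take d e @ [e ! d])) (\<lambda>G X e. w G X (take d e) (e ! d))"
    using f
    by (rule poly_time_cong) (simp_all add: vertex_tuple_def take_Suc_conv_app_nth[symmetric])
  from poly_time_if[OF poly_decidable_definable[OF N, of "Suc d" d] this
      poly_computable_const[of _ 0]]
  have "poly_time (Suc d)
      (\<lambda>G X e. if e ! d \<in> N G X (take d e) then f G X (take d e @ [e ! d]) else 0)
      (\<lambda>G X e. if e ! d \<in> N G X (take d e) then w G X (take d e) (e ! d) else [])"
    by simp
  from poly_time_for[OF this] show ?thesis
    unfolding poly_writable_def elements_def concat_map_if_Nil by blast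
qed

lemma set_elements:
  "definable d N \<Longrightarrow> vertex_tuple d G X e \<Longrightarrow> set (elements N G X e) = N G X e"
  using definable_subset[of d N G X e]
  by (auto simp: elements_def vertex_tuple_def numbered_instance_def)

lemma enumerates_elements:
  assumes "definable 0 N" and "numbered_instance G X"
  shows "enumerates (elements N G X []) (induced (N G X []) G)"
  using set_elements[OF assms(1), of G X "[]"] assms(2)
  by (simp add: enumerates_def elements_def vertex_tuple_def)

lemma encode_induced:
  assumes "set us = K"
  shows "encode us (induced K G) X = [length us] @ concat (map (\<lambda>v. [of_bool (v \<in> X)]) us) @
    concat (map (\<lambda>u. concat (map (\<lambda>v. [of_bool ((u, v) \<in> parcs G)]) us)) us)"
proof -
  have rows: "map (\<lambda>u. map (\<lambda>v. of_bool ((u, v) \<in> parcs (induced K G))) us) us =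
      (map (\<lambda>u. map (\<lambda>v. of_bool ((u, v) \<in> parcs G)) us) us :: nat list list)"
    using assms by (auto simp: pullback_def)
  show ?thesis
    unfolding encode_def rows by (simp add: concat_map_singleton)
qed

lemma poly_writable_adjacency_matrix:
  assumes "definable 0 K"
  shows "poly_writable 0 (\<lambda>G X e. concat (map (\<lambda>u.
    concat (map (\<lambda>v. [of_bool ((u, v) \<in> parcs G)]) (elements K G X e))) (elements K G X e)))"
proof (rule poly_writable_concat_elements[OF assms])
  have "definable 1 (\<lambda>G X e. K G X (take 0 e))"
    using assms by (rule definable_take) simp
  moreover have "poly_writable (Suc 1) (\<lambda>G X e. [of_bool ((take 1 e ! 0, e ! 1) \<in> parcs G)])"
    using poly_decidable_adjacent[of 0 2 1]
    by (intro poly_writable_value) (simp add: numeral_2_eq_2)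
  ultimately have "poly_writable 1 (\<lambda>G X e. concat (map (\<lambda>v. [of_bool ((e ! 0, v) \<in> parcs G)])
      (elements (\<lambda>G X e. K G X (take 0 e)) G X e)))"
    by (rule poly_writable_concat_elements)
  then show "poly_writable (Suc 0) (\<lambda>G X e. concat (map (\<lambda>v. [of_bool ((e ! 0, v) \<in> parcs G)])
      (elements K G X (take 0 e))))"
    by (simp add: elements_def)
qed

lemma poly_writable_encode_induced:
  assumes "definable 0 K"
  shows "poly_writable 0 (\<lambda>G X e. encode (elements K G X e) (induced (K G X e) G) X)"
proof -
  have "poly_computable 0 (\<lambda>G X e. card {v \<in> pverts G. v \<in> K G X e})"
    using poly_decidable_definable[OF assms, of 1 0] by (intro poly_computable_card) simp
  moreover have "poly_writable 0 (\<lambda>G X e. concat (map (\<lambda>v. [of_bool (v \<in> X)]) (elements K G X e)))"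
    using poly_decidable_member[of 0 1]
    by (intro poly_writable_concat_elements[OF assms] poly_writable_value) simp
  ultimately have "poly_writable 0 (\<lambda>G X e. [card {v \<in> pverts G. v \<in> K G X e}] @
      concat (map (\<lambda>v. [of_bool (v \<in> X)]) (elements K G X e)) @
      concat (map (\<lambda>u. concat (map (\<lambda>v. [of_bool ((u, v) \<in> parcs G)]) (elements K G X e)))
        (elements K G X e)))"
    by (intro poly_writable_append poly_writable_value poly_writable_adjacency_matrix[OF assms])
  then show ?thesis
  proof (rule poly_writable_cong)
    fix G :: "nat pair_pre_digraph" and X and e :: "nat list"
    assume "vertex_tuple 0 G X e"
    then have set: "set (elements K G X e) = K G X e" and "K G X e \<subseteq> pverts G"
      using set_elements[OF assms] definable_subset[OF assms] by blast+
    then have "{v \<in> pverts G. v \<in> K G X e} = set (elements K G X e)"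
      by blast
    then have "card {v \<in> pverts G. v \<in> K G X e} = length (elements K G X e)"
      by (simp add: distinct_card elements_def del: set_filter)
    with set show "[card {v \<in> pverts G. v \<in> K G X e}] @
        concat (map (\<lambda>v. [of_bool (v \<in> X)]) (elements K G X e)) @
        concat (map (\<lambda>u. concat (map (\<lambda>v. [of_bool ((u, v) \<in> parcs G)]) (elements K G X e)))
          (elements K G X e)) = encode (elements K G X e) (induced (K G X e) G) X"
      by (simp add: encode_induced)
  qed
qed

lemma poly_nat_mono: "(m :: nat) \<le> n \<Longrightarrow> poly p m \<le> poly p n"
  by (induction p) (auto intro!: add_mono mult_mono)

lemma ram_computes_if_poly_writable:
  assumes "poly_writable 0 w"
  obtains c p where "\<And>G X. numbered_instance G X \<Longrightarrow> ram_computes_within c (encode_numbered G X)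
    (poly p (length (encode_numbered G X))) (w G X [])"
proof -
  obtain f where f: "poly_time 0 f w"
    using assms unfolding poly_writable_def by blast
  obtain c p where run: "\<And>G X s. ready 0 G X s \<Longrightarrow>
      runs c s (poly p (reg s 0)) (yields 0 (f G X (vars 0 s)) (w G X (vars 0 s)) s)"
    using f by (rule poly_timeE) blast
  show thesis
  proof (rule that)
    fix G X
    assume "numbered_instance G X"
    let ?s = "input_state (encode_numbered G X)" and ?n = "card (pverts G)"
    let ?s' = "set_reg 1 1 (set_reg 0 (mem ?s (reg ?s 0)) ?s)"
    have s': "reg ?s' 0 = ?n" "out ?s' = []" "ready 0 G X ?s'"
      using \<open>numbered_instance G X\<close> mem_encode(1)[of "[0..<?n]" G X]
      by (simp_all add: ready_def vertex_tuple_def vars_def input_state_def)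
    have "runs (Seq (Load 0 0) (Seq (Const 1 1) c)) ?s (1 + (1 + poly p ?n)) (\<lambda>s. out s = w G X [])"
      using runs_mono[OF run[OF s'(3)], of "poly p ?n"] s'
      by (intro runs_Seq runs_instr) (auto simp: yields_def vars_def)
    moreover have "?n \<le> length (encode_numbered G X)"
      by (simp add: encode_def)
    then have "1 + (1 + poly p ?n) \<le> poly (p + [:2:]) (length (encode_numbered G X))"
      using poly_nat_mono[of ?n _ p] by simp
    ultimately show "ram_computes_within (Seq (Load 0 0) (Seq (Const 1 1) c)) (encode_numbered G X)
        (poly (p + [:2:]) (length (encode_numbered G X))) (w G X [])"
      unfolding ram_computes_within_def runs_def by (meson order_trans)
  qed
qed

section \<open>The kernelization\<close>

lemma encode_pullback_nth:
  "encode [0..<length vs] (pullback ((!) vs) {..<length vs} G) {i \<in> {..<length vs}. vs ! i \<in> X} =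
    encode vs G X"
proof -
  have "encode vs G X = encode (map ((!) vs) [0..<length vs]) G X"
    by (simp add: map_nth)
  also have "\<dots> = encode [0..<length vs] (pullback ((!) vs) {..<length vs} G)
      {i \<in> {..<length vs}. vs ! i \<in> X}"
    by (auto simp: encode_def pullback_def comp_def intro!: arg_cong[of _ _ concat])
  finally show ?thesis
    by simp
qed

lemma card_inj_vimage:
  assumes "inj_on f U" and "X \<subseteq> f ` U"
  shows "card {u \<in> U. f u \<in> X} = card X"
proof -
  have "f ` {u \<in> U. f u \<in> X} = X"
    using assms(2) by auto
  moreover have "inj_on f {u \<in> U. f u \<in> X}"
    using assms(1) by (rule inj_on_subset) blast
  ultimately show ?thesis
    using card_image by metis
qed

lemma isomorphic_numbered_instance:
  assumes inst: "mod_co_cluster_instance G X" and "enumerates vs G"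
  obtains H Y where "mod_co_cluster_instance H Y" and "numbered_instance H Y"
    and "encode_numbered H Y = encode vs G X" and "card Y = card X"
    and "has_stable_cutset H \<longleftrightarrow> has_stable_cutset G"
proof
  let ?n = "length vs"
  let ?H = "pullback ((!) vs) {..<?n} G" and ?Y = "{i \<in> {..<?n}. vs ! i \<in> X}"
  have G: "pair_graph G" "X \<subseteq> pverts G"
    using inst by (simp_all add: mod_co_cluster_instance_def)
  have "bij_betw ((!) vs) {..<?n} (pverts G)"
    using assms(2) bij_betw_nth[of vs "{..<?n}" "pverts G"] by (simp add: enumerates_def)
  then have inj: "inj_on ((!) vs) {..<?n}" and image: "(!) vs ` {..<?n} = pverts G"
    by (simp_all add: bij_betw_def)
  show H: "mod_co_cluster_instance ?H ?Y"
    using mod_co_cluster_instance_pullback[OF inst, of "{..<?n}" "(!) vs"] image by simp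
  show "numbered_instance ?H ?Y"
    by (auto simp: numbered_instance_def pullback_def)
  show "encode_numbered ?H ?Y = encode vs G X"
    using encode_pullback_nth[of vs G X] by simp
  show "card ?Y = card X"
    using card_inj_vimage[OF inj] G(2) image by simp
  show "has_stable_cutset ?H \<longleftrightarrow> has_stable_cutset G"
    using has_stable_cutset_pullback_iff[OF _ inj, of G] has_stable_cutset_iff_separable[OF G(1)]
      H image by (simp add: mod_co_cluster_instance_def)
qed

theorem theorem6:
  shows "\<exists>(c :: com) (p :: nat poly) (k :: nat) (k\<^sub>0 :: nat).
    \<forall>(G :: nat pair_pre_digraph) X vs.
      mod_co_cluster_instance G X \<and> enumerates vs G \<longrightarrow>
      (\<exists>(G' :: nat pair_pre_digraph) X' vs'.
         mod_co_cluster_instance G' X' \<and> enumerates vs' G' \<and>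
         ram_computes_within c (encode vs G X)
           (poly p (length (encode vs G X))) (encode vs' G' X') \<and>
         (has_stable_cutset G' \<longleftrightarrow> has_stable_cutset G) \<and>
         (card (pverts G') \<le> k * card X ^ 3 \<or> card (pverts G') \<le> k\<^sub>0))"
proof -
  let ?K = "\<lambda>G X _. cutset_kernel (pverts G) (parcs G) X"
  obtain c p where compute: "\<And>G X. numbered_instance G X \<Longrightarrow>
      ram_computes_within c (encode_numbered G X) (poly p (length (encode_numbered G X)))
        (encode (elements ?K G X []) (induced (?K G X []) G) X)"
    using poly_writable_encode_induced[OF definable_cutset_kernel]
    by (rule ram_computes_if_poly_writable) blast
  show ?thesis
  proof (rule exI[of _ c], rule exI[of _ p], rule exI[of _ 13], rule exI[of _ 9],
      intro allI impI, elim conjE, goal_cases)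
    case (1 G X vs)
    then obtain H Y where H: "mod_co_cluster_instance H Y" and numbered: "numbered_instance H Y"
        and encode: "encode_numbered H Y = encode vs G X" and card: "card Y = card X"
        and iso: "has_stable_cutset H \<longleftrightarrow> has_stable_cutset G"
      by (rule isomorphic_numbered_instance)
    let ?H' = "induced (?K H Y []) H"
    have "card (pverts ?H') \<le> 13 * card X ^ 3 \<or> card (pverts ?H') \<le> 9"
      using card_cutset_kernel_le_cubic[of "pverts H" Y "parcs H"] numbered
      by (simp add: finite_pverts_numbered card numbered_instance_def)
    then show ?case
      using has_stable_cutset_induced_cutset_kernel[OF H] iso compute[OF numbered]
        enumerates_elements[OF definable_cutset_kernel numbered] unfolding encode by blast
  qed
qed

end
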